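(* Let $t(x)=\top$ be a nontrivial one-variable equation in the language of Heyting algebras such that $\{x\in H : \neg\neg x=\top\}\subseteq\{x\in H : t(x)=\top\}$ in every Heyting algebra $H$. Then the equation $t(x)=\top$ does not have dimensional gap (with respect to the theory of Heyting algebras); that is, there is an infinite definable Heyting algebra $L$ such that $\{x\in L : t(x)=\top\}\ne L$ but $\dim\{x\in L : t(x)=\top\}=\dim L$.
   Context: Fix an o-minimal structure $R$ expanding a real-closed field. "Definable" means definable in $R$ with parameters; $\dim$ is o-minimal dimension. A Heyting algebra is a bounded distributive lattice $(H,\sqsubseteq)$ in which for all $x,y\in H$ the set $\{z\in H : x\sqcap z\sqsubseteq y\}$ has a maximum element, denoted $x\Rightarrow y$; $\neg x$ abbreviates $x\Rightarrow\bot$. It is definable if $H$ is a definable subset of some $R^n$ and $\sqsubseteq$ is a definable relation. Terms are parameter-free terms in $\sqcap,\sqcup,\Rightarrow,\bot,\top$. An equation in one variable is trivial if it always defines the whole algebra or always defines the empty set; for the equations considered here (whose solution set always contains $\top$), nontrivial means that the equation is not valid in all Heyting algebras. Dimensional gap: for a first-order language $\mathcal L$ and an $\mathcal L$-theory $T$, an $\mathcal L$-formula $\varphi(x_1,\dots,x_n)$ has dimensional gap if in every infinite definable $\mathcal L$-structure $M\models T$ either $\dim M^n>\dim\{\bar x\in M^n : \varphi(\bar x)\}$ or $M^n=\{\bar x\in M^n : \varphi(\bar x)\}$. *)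

theory Defs
  imports
    Complex_Main
    "HOL-Library.Extended_Real"
    "HOL-Library.Infinite_Typeclass"
    "HOL-Computational_Algebra.Polynomial"
    "HOL-Algebra.Lattice"
begin

section \<open>First-order logic\<close>

text \<open>
  The symbols of a language are the elements of the types \<open>'f\<close> and \<open>'r\<close>; the record only
  carries their arities. Nullary function symbols are the constants. Interpretations are
  meaningful only on argument lists of the right length with entries in the universe.
\<close>

record ('f, 'r) lang =
  fun_ar :: "'f \<Rightarrow> nat"
  rel_ar :: "'r \<Rightarrow> nat"

record ('f, 'r, 'a) fo_struct =
  univ :: "'a set"
  fun_int :: "'f \<Rightarrow> 'a list \<Rightarrow> 'a"
  rel_int :: "'r \<Rightarrow> 'a list \<Rightarrow> bool"

datatype 'f tm = Var nat | Fn 'f "'f tm list"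

datatype ('f, 'r) fm =
    FEq "'f tm" "'f tm"
  | FRel 'r "'f tm list"
  | FNot "('f, 'r) fm"
  | FAnd "('f, 'r) fm" "('f, 'r) fm"
  | FImp "('f, 'r) fm" "('f, 'r) fm"
  | FAll nat "('f, 'r) fm"

fun tm_vars :: "'f tm \<Rightarrow> nat set" where
  "tm_vars (Var i) = {i}"
| "tm_vars (Fn f ts) = (\<Union>t\<in>set ts. tm_vars t)"

fun wf_tm :: "('f, 'r) lang \<Rightarrow> 'f tm \<Rightarrow> bool" where
  "wf_tm \<L> (Var i) \<longleftrightarrow> True"
| "wf_tm \<L> (Fn f ts) \<longleftrightarrow> length ts = fun_ar \<L> f \<and> (\<forall>t\<in>set ts. wf_tm \<L> t)"

fun wf_fm :: "('f, 'r) lang \<Rightarrow> ('f, 'r) fm \<Rightarrow> bool" where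
  "wf_fm \<L> (FEq s t) \<longleftrightarrow> wf_tm \<L> s \<and> wf_tm \<L> t"
| "wf_fm \<L> (FRel r ts) \<longleftrightarrow> length ts = rel_ar \<L> r \<and> (\<forall>t\<in>set ts. wf_tm \<L> t)"
| "wf_fm \<L> (FNot \<phi>) \<longleftrightarrow> wf_fm \<L> \<phi>"
| "wf_fm \<L> (FAnd \<phi> \<psi>) \<longleftrightarrow> wf_fm \<L> \<phi> \<and> wf_fm \<L> \<psi>"
| "wf_fm \<L> (FImp \<phi> \<psi>) \<longleftrightarrow> wf_fm \<L> \<phi> \<and> wf_fm \<L> \<psi>"
| "wf_fm \<L> (FAll i \<phi>) \<longleftrightarrow> wf_fm \<L> \<phi>"

fun tm_val :: "('f, 'r, 'a) fo_struct \<Rightarrow> (nat \<Rightarrow> 'a) \<Rightarrow> 'f tm \<Rightarrow> 'a" where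
  "tm_val M e (Var i) = e i"
| "tm_val M e (Fn f ts) = fun_int M f (map (tm_val M e) ts)"

fun sat :: "('f, 'r, 'a) fo_struct \<Rightarrow> (nat \<Rightarrow> 'a) \<Rightarrow> ('f, 'r) fm \<Rightarrow> bool" where
  "sat M e (FEq s t) \<longleftrightarrow> tm_val M e s = tm_val M e t"
| "sat M e (FRel r ts) \<longleftrightarrow> rel_int M r (map (tm_val M e) ts)"
| "sat M e (FNot \<phi>) \<longleftrightarrow> \<not> sat M e \<phi>"
| "sat M e (FAnd \<phi> \<psi>) \<longleftrightarrow> sat M e \<phi> \<and> sat M e \<psi>"
| "sat M e (FImp \<phi> \<psi>) \<longleftrightarrow> (sat M e \<phi> \<longrightarrow> sat M e \<psi>)"
| "sat M e (FAll i \<phi>) \<longleftrightarrow> (\<forall>a\<in>univ M. sat M (e(i := a)) \<phi>)"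

definition is_struct :: "('f, 'r) lang \<Rightarrow> ('f, 'r, 'a) fo_struct \<Rightarrow> bool" where
  "is_struct \<L> M \<longleftrightarrow> univ M \<noteq> {} \<and>
     (\<forall>f xs. length xs = fun_ar \<L> f \<and> set xs \<subseteq> univ M \<longrightarrow> fun_int M f xs \<in> univ M)"

text \<open>Applied to sets of sentences, for which the choice of the assignment is irrelevant.\<close>

definition models :: "('f, 'r, 'a) fo_struct \<Rightarrow> ('f, 'r) fm set \<Rightarrow> bool" where
  "models M T \<longleftrightarrow> (\<forall>\<phi>\<in>T. \<forall>e. range e \<subseteq> univ M \<longrightarrow> sat M e \<phi>)"


section \<open>O-minimal expansions of real closed fields\<close>

text \<open>
  \<open>R\<^sup>n\<close> is the set of lists of length \<open>n\<close>. The variables below \<open>n\<close> of the defining formula are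
  the coordinates; all other free variables are parameters, whose values are given by \<open>e\<close>.
\<close>

definition definable ::
    "('f, 'r) lang \<Rightarrow> ('f, 'r, 'a) fo_struct \<Rightarrow> nat \<Rightarrow> 'a list set \<Rightarrow> bool" where
  "definable \<L> R n X \<longleftrightarrow> (\<exists>\<phi> e. wf_fm \<L> \<phi> \<and> range e \<subseteq> univ R \<and>
     X = {xs. length xs = n \<and> set xs \<subseteq> univ R \<and> sat R (\<lambda>i. if i < n then xs ! i else e i) \<phi>})"

definition real_closed_field :: "'a::linordered_field itself \<Rightarrow> bool" where
  "real_closed_field _ \<longleftrightarrow> (\<forall>x::'a. 0 \<le> x \<longrightarrow> (\<exists>y. y ^ 2 = x)) \<and>
     (\<forall>p::'a poly. odd (degree p) \<longrightarrow> (\<exists>x. poly p x = 0))"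

definition expands_ordered_field ::
    "('f, 'r) lang \<Rightarrow> ('f, 'r, 'a::linordered_field) fo_struct \<Rightarrow> bool" where
  "expands_ordered_field \<L> R \<longleftrightarrow> univ R = UNIV \<and>
     (\<exists>f. fun_ar \<L> f = 0 \<and> fun_int R f [] = 0) \<and>
     (\<exists>f. fun_ar \<L> f = 0 \<and> fun_int R f [] = 1) \<and>
     (\<exists>f. fun_ar \<L> f = 2 \<and> (\<forall>x y. fun_int R f [x, y] = x + y)) \<and>
     (\<exists>f. fun_ar \<L> f = 1 \<and> (\<forall>x. fun_int R f [x] = - x)) \<and>
     (\<exists>f. fun_ar \<L> f = 2 \<and> (\<forall>x y. fun_int R f [x, y] = x * y)) \<and>
     (\<exists>r. rel_ar \<L> r = 2 \<and> (\<forall>x y. rel_int R r [x, y] \<longleftrightarrow> x < y))"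

definition point_or_open_interval :: "'a::linorder set \<Rightarrow> bool" where
  "point_or_open_interval J \<longleftrightarrow>
     (\<exists>a. J = {a}) \<or> (\<exists>a b. J = {a<..<b}) \<or> (\<exists>a. J = {a<..}) \<or> (\<exists>b. J = {..<b}) \<or> J = UNIV"

definition o_minimal :: "('f, 'r) lang \<Rightarrow> ('f, 'r, 'a::linorder) fo_struct \<Rightarrow> bool" where
  "o_minimal \<L> R \<longleftrightarrow> (\<forall>X. definable \<L> R 1 X \<longrightarrow>
     (\<exists>\<J>. finite \<J> \<and> (\<forall>J\<in>\<J>. point_or_open_interval J) \<and> {x. [x] \<in> X} = \<Union>\<J>))"

locale o_minimal_field =
  fixes \<L> :: "('f, 'r) lang"
    and R :: "('f, 'r, 'a::linordered_field) fo_struct"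
  assumes real_closed: "real_closed_field TYPE('a)"
    and expands: "expands_ordered_field \<L> R"
    and o_minimal: "o_minimal \<L> R"


section \<open>Cells and o-minimal dimension\<close>

text \<open>Continuity on \<open>X \<subseteq> R\<^sup>n\<close> for the order topology on \<open>R\<close> and the product topology on \<open>R\<^sup>n\<close>.\<close>

definition continuous_on_list :: "'a::linordered_field list set \<Rightarrow> ('a list \<Rightarrow> 'a) \<Rightarrow> bool" where
  "continuous_on_list X f \<longleftrightarrow> (\<forall>x\<in>X. \<forall>\<epsilon>>0. \<exists>\<delta>>0. \<forall>y\<in>X.
     (\<forall>i<length x. \<bar>y ! i - x ! i\<bar> < \<delta>) \<longrightarrow> \<bar>f y - f x\<bar> < \<epsilon>)"

definition definable_continuous ::
    "('f, 'r) lang \<Rightarrow> ('f, 'r, 'a::linordered_field) fo_struct \<Rightarrow> nat \<Rightarrow>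
      'a list set \<Rightarrow> ('a list \<Rightarrow> 'a) \<Rightarrow> bool" where
  "definable_continuous \<L> R n X f \<longleftrightarrow>
     definable \<L> R (Suc n) {x @ [f x] | x. x \<in> X} \<and> continuous_on_list X f"

text \<open>
  \<open>cell \<L> R is C\<close> says that \<open>C\<close> is an \<open>(i\<^sub>1, \<dots>, i\<^sub>n)\<close>-cell, where \<open>is = [i\<^sub>1, \<dots>, i\<^sub>n]\<close>.
  The recursion starts at the one-point space \<open>R\<^sup>0\<close>. In \<open>band\<close>, the bounds \<open>lo = None\<close> and
  \<open>hi = None\<close> stand for the constant functions \<open>-\<infinity>\<close> and \<open>+\<infinity>\<close>.
\<close>

inductive cell ::
    "('f, 'r) lang \<Rightarrow> ('f, 'r, 'a::linordered_field) fo_struct \<Rightarrow> nat list \<Rightarrow> 'a list set \<Rightarrow> bool"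
  for \<L> R where
  point: "cell \<L> R [] {[]}"
| graph: "cell \<L> R (is @ [0]) {x @ [f x] | x. x \<in> C}"
    if "cell \<L> R is C" and "definable_continuous \<L> R (length is) C f"
| band: "cell \<L> R (is @ [1])
      {x @ [y] | x y. x \<in> C \<and> (\<forall>f. lo = Some f \<longrightarrow> f x < y) \<and> (\<forall>g. hi = Some g \<longrightarrow> y < g x)}"
    if "cell \<L> R is C"
      and "\<And>f. lo = Some f \<Longrightarrow> definable_continuous \<L> R (length is) C f"
      and "\<And>g. hi = Some g \<Longrightarrow> definable_continuous \<L> R (length is) C g"
      and "\<And>f g x. lo = Some f \<Longrightarrow> hi = Some g \<Longrightarrow> x \<in> C \<Longrightarrow> f x < g x"

text \<open>The supremum in \<open>ereal\<close> makes the dimension of the empty set \<open>-\<infinity>\<close>.\<close>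

definition odim ::
    "('f, 'r) lang \<Rightarrow> ('f, 'r, 'a::linordered_field) fo_struct \<Rightarrow> 'a list set \<Rightarrow> ereal" where
  "odim \<L> R X = (SUP is\<in>{is. \<exists>C. cell \<L> R is C \<and> C \<subseteq> X}. ereal (real (sum_list is)))"


section \<open>Definable structures and dimensional gap\<close>

text \<open>
  A structure whose universe \<open>M\<close> is a definable subset of \<open>R\<^sup>m\<close>. Via \<^const>\<open>concat\<close>, subsets of
  \<open>M\<^sup>k\<close>, which are sets of lists of lists, become subsets of \<open>R\<^sup>m\<^sup>k\<close>.
\<close>

definition definable_struct ::
    "('f, 'r) lang \<Rightarrow> ('f, 'r, 'a) fo_struct \<Rightarrow>
      ('g, 's) lang \<Rightarrow> nat \<Rightarrow> ('g, 's, 'a list) fo_struct \<Rightarrow> bool" where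
  "definable_struct \<L> R \<L>' m M \<longleftrightarrow> is_struct \<L>' M \<and> definable \<L> R m (univ M) \<and>
     (\<forall>f. definable \<L> R (m * fun_ar \<L>' f + m)
        {concat xs @ fun_int M f xs | xs. length xs = fun_ar \<L>' f \<and> set xs \<subseteq> univ M}) \<and>
     (\<forall>r. definable \<L> R (m * rel_ar \<L>' r)
        {concat xs | xs. length xs = rel_ar \<L>' r \<and> set xs \<subseteq> univ M \<and> rel_int M r xs})"

definition struct_power :: "('g, 's, 'b) fo_struct \<Rightarrow> nat \<Rightarrow> 'b list set" where
  "struct_power M n = {xs. length xs = n \<and> set xs \<subseteq> univ M}"

text \<open>For formulas all of whose free variables are below \<open>n\<close>.\<close>

definition solutions :: "('g, 's, 'b) fo_struct \<Rightarrow> nat \<Rightarrow> ('g, 's) fm \<Rightarrow> 'b list set" where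
  "solutions M n \<phi> = {xs \<in> struct_power M n. sat M (\<lambda>i. xs ! i) \<phi>}"

definition dimensional_gap ::
    "('f, 'r) lang \<Rightarrow> ('f, 'r, 'a::linordered_field) fo_struct \<Rightarrow>
      ('g, 's) lang \<Rightarrow> ('g, 's) fm set \<Rightarrow> nat \<Rightarrow> ('g, 's) fm \<Rightarrow> bool" where
  "dimensional_gap \<L> R \<L>' T n \<phi> \<longleftrightarrow>
     (\<forall>(M :: ('g, 's, 'a list) fo_struct) m.
        definable_struct \<L> R \<L>' m M \<and> infinite (univ M) \<and> models M T \<longrightarrow>
          odim \<L> R (concat ` struct_power M n) > odim \<L> R (concat ` solutions M n \<phi>) \<or>
          struct_power M n = solutions M n \<phi>)"


section \<open>Heyting algebras\<close>

locale heyting_algebra = bounded_lattice H for H (structure) +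
  assumes distrib: "\<lbrakk>x \<in> carrier H; y \<in> carrier H; z \<in> carrier H\<rbrakk> \<Longrightarrow>
      x \<sqinter> (y \<squnion> z) = (x \<sqinter> y) \<squnion> (x \<sqinter> z)"
    and imp_exists: "\<lbrakk>x \<in> carrier H; y \<in> carrier H\<rbrakk> \<Longrightarrow>
      \<exists>m. greatest H m {z \<in> carrier H. x \<sqinter> z \<sqsubseteq> y}"

definition himp :: "('a, 'b) gorder_scheme \<Rightarrow> 'a \<Rightarrow> 'a \<Rightarrow> 'a" where
  "himp H x y = (THE m. greatest H m {z \<in> carrier H. x \<sqinter>\<^bsub>H\<^esub> z \<sqsubseteq>\<^bsub>H\<^esub> y})"

datatype heyting_fun = Meet | Join | Imp | Bot | Top

datatype heyting_rel = Le

type_synonym heyting_term = "heyting_fun tm"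

definition heyting_lang :: "(heyting_fun, heyting_rel) lang" where
  "heyting_lang = \<lparr>
     fun_ar = (\<lambda>f. case f of Meet \<Rightarrow> 2 | Join \<Rightarrow> 2 | Imp \<Rightarrow> 2 | Bot \<Rightarrow> 0 | Top \<Rightarrow> 0),
     rel_ar = (\<lambda>r. case r of Le \<Rightarrow> 2)\<rparr>"

fun heyting_op :: "('a, 'b) gorder_scheme \<Rightarrow> heyting_fun \<Rightarrow> 'a list \<Rightarrow> 'a" where
  "heyting_op H Meet [x, y] = x \<sqinter>\<^bsub>H\<^esub> y"
| "heyting_op H Join [x, y] = x \<squnion>\<^bsub>H\<^esub> y"
| "heyting_op H Imp [x, y] = himp H x y"
| "heyting_op H Bot [] = \<bottom>\<^bsub>H\<^esub>"
| "heyting_op H Top [] = \<top>\<^bsub>H\<^esub>"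
| "heyting_op H _ _ = undefined"

definition heyting_struct ::
    "('a, 'b) gorder_scheme \<Rightarrow> (heyting_fun, heyting_rel, 'a) fo_struct" where
  "heyting_struct H = \<lparr>univ = carrier H, fun_int = heyting_op H,
     rel_int = (\<lambda>Le xs. xs ! 0 \<sqsubseteq>\<^bsub>H\<^esub> xs ! 1)\<rparr>"

definition heyting_theory :: "(heyting_fun, heyting_rel) fm set" where
  "heyting_theory =
     (let x = Var 0; y = Var 1; z = Var 2;
          meet = (\<lambda>s t. Fn Meet [s, t]); join = (\<lambda>s t. Fn Join [s, t]);
          imp = (\<lambda>s t. Fn Imp [s, t]); le = (\<lambda>s t. FRel Le [s, t])
      in (\<lambda>\<phi>. FAll 0 (FAll 1 (FAll 2 \<phi>))) `
        {le x x,
         FImp (FAnd (le x y) (le y x)) (FEq x y),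
         FImp (FAnd (le x y) (le y z)) (le x z),
         le (meet x y) x,
         le (meet x y) y,
         FImp (FAnd (le z x) (le z y)) (le z (meet x y)),
         le x (join x y),
         le y (join x y),
         FImp (FAnd (le x z) (le y z)) (le (join x y) z),
         le (Fn Bot []) x,
         le x (Fn Top []),
         FEq (meet x (join y z)) (join (meet x y) (meet x z)),
         le (meet x (imp x y)) y,
         FImp (le (meet x z) y) (le z (imp x y))})"

definition eq_top :: "heyting_term \<Rightarrow> (heyting_fun, heyting_rel) fm" where
  "eq_top t = FEq t (Fn Top [])"

definition one_variable :: "heyting_term \<Rightarrow> bool" where
  "one_variable t \<longleftrightarrow> wf_tm heyting_lang t \<and> tm_vars t \<subseteq> {0}"

definition hneg :: "heyting_term \<Rightarrow> heyting_term" where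
  "hneg s = Fn Imp [s, Fn Bot []]"

text \<open>
  The value of \<open>t\<close> at \<open>x\<close> is computed with every variable set to \<open>x\<close>; for terms satisfying
  \<^const>\<open>one_variable\<close> only \<open>Var 0\<close> matters.
\<close>

definition solution_set :: "('a, 'b) gorder_scheme \<Rightarrow> heyting_term \<Rightarrow> 'a set" where
  "solution_set H t = {x \<in> carrier H. sat (heyting_struct H) (\<lambda>_. x) (eq_top t)}"

text \<open>
  HOL cannot quantify over types inside a formula, so the Heyting algebras considered here are
  those whose carrier is a set of elements of \<open>'h\<close>; the type \<open>'h\<close> itself is left arbitrary.
  (Every set-sized Heyting algebra is isomorphic to one of this kind for a suitable \<open>'h\<close>.)
\<close>

definition trivial_equation :: "'h itself \<Rightarrow> heyting_term \<Rightarrow> bool" where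
  "trivial_equation _ t \<longleftrightarrow>
     (\<forall>H :: 'h gorder. heyting_algebra H \<longrightarrow> solution_set H t = carrier H) \<or>
     (\<forall>H :: 'h gorder. heyting_algebra H \<longrightarrow> solution_set H t = {})"

definition definable_heyting_algebra ::
    "('f, 'r) lang \<Rightarrow> ('f, 'r, 'a) fo_struct \<Rightarrow> 'a list gorder \<Rightarrow> bool" where
  "definable_heyting_algebra \<L> R H \<longleftrightarrow> heyting_algebra H \<and>
     (\<exists>n. definable \<L> R n (carrier H) \<and>
       definable \<L> R (n + n) {x @ y | x y. x \<in> carrier H \<and> y \<in> carrier H \<and> x \<sqsubseteq>\<^bsub>H\<^esub> y})"

end

theory Submission
  imports Defs
begin

text \<open>
  If \<open>t(x) = \<top>\<close> fails somewhere, it fails at some \<open>x\<close> of a finite Heyting algebra \<open>D\<close>, namely a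
  finite bounded sublattice containing the values of all subterms of \<open>t\<close>: it has its own
  implication, which agrees with the given one as far as the evaluation of \<open>t\<close> is concerned. The
  algebra \<open>L = D \<times> [0, 1]\<close> is definable in \<open>R\<^sup>1\<close> as a disjoint union of the segments \<open>[2i, 2i + 1]\<close>,
  one for each element of \<open>D\<close>, so it has dimension 1, and the equation fails at \<open>(x, 0)\<close>. In the
  chain \<open>[0, 1]\<close> every \<open>r > 0\<close> satisfies \<open>\<not>\<not>r = \<top>\<close>; hence the equation holds on the
  one-dimensional set of the \<open>(\<top>, r)\<close> with \<open>0 < r < 1\<close>.
\<close>

text \<open>Heyting subalgebras would not serve for \<open>D\<close>: one element can generate an
  infinite one, as in the free Heyting algebra on one generator, whereas finitely generated
  distributive lattices are finite. Neither factor of \<open>L\<close> suffices alone: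
  \<open>D\<close> is finite, and a chain may satisfy the equation everywhere, as it does \<not>x
  \<squnion> \<not>\<not>x = \<top>. In the product, terms are evaluated coordinatewise, so a
  failure in \<open>D\<close> and validity over a whole open segment coexist. The hypothesis on
  \<open>t\<close> speaks only of algebras carried by \<open>'h\<close>, and nothing relates the
  size of \<open>'h\<close> to that of \<open>'a\<close>. It is therefore applied to finite algebras
  only: to \<open>D\<close>, which is cut out of an algebra on \<open>'h\<close>, and to a
  three-element chain, which fits into every infinite type. Homomorphisms carry the outcome over to
  \<open>L\<close>. For definability only the order of \<open>L\<close> is written out by hand; the
  operations are first-order definable from it.\<close>

section \<open>Heyting algebras presented by operations\<close>

text \<open>The lattice operations and \<open>himp\<close> are obtained from the order by choice and
  description, which is awkward for computing. Here explicit candidates are pinned down by one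
  equivalence each, and the equations \<open>meet_eq\<close> to \<open>himp_eq\<close> then identify
  them with the official operations.\<close>

locale heyting_operations = partial_order H for H (structure) +
  fixes mt jn im :: "'a \<Rightarrow> 'a \<Rightarrow> 'a" and bt tp :: 'a
  assumes mt_closed: "\<lbrakk>x \<in> carrier H; y \<in> carrier H\<rbrakk> \<Longrightarrow> mt x y \<in> carrier H"
    and jn_closed: "\<lbrakk>x \<in> carrier H; y \<in> carrier H\<rbrakk> \<Longrightarrow> jn x y \<in> carrier H"
    and im_closed: "\<lbrakk>x \<in> carrier H; y \<in> carrier H\<rbrakk> \<Longrightarrow> im x y \<in> carrier H"
    and bt_closed: "bt \<in> carrier H"
    and tp_closed: "tp \<in> carrier H"
    and le_mt_iff: "\<lbrakk>x \<in> carrier H; y \<in> carrier H; z \<in> carrier H\<rbrakk> \<Longrightarrow>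
      z \<sqsubseteq> mt x y \<longleftrightarrow> z \<sqsubseteq> x \<and> z \<sqsubseteq> y"
    and jn_le_iff: "\<lbrakk>x \<in> carrier H; y \<in> carrier H; z \<in> carrier H\<rbrakk> \<Longrightarrow>
      jn x y \<sqsubseteq> z \<longleftrightarrow> x \<sqsubseteq> z \<and> y \<sqsubseteq> z"
    and le_im_iff: "\<lbrakk>x \<in> carrier H; y \<in> carrier H; z \<in> carrier H\<rbrakk> \<Longrightarrow>
      z \<sqsubseteq> im x y \<longleftrightarrow> mt x z \<sqsubseteq> y"
    and bt_le: "x \<in> carrier H \<Longrightarrow> bt \<sqsubseteq> x"
    and le_tp: "x \<in> carrier H \<Longrightarrow> x \<sqsubseteq> tp"
begin

lemma mt_greatest:
  assumes "x \<in> carrier H" "y \<in> carrier H"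
  shows "greatest H (mt x y) (Lower H {x, y})"
  using assms mt_closed[OF assms] le_mt_iff[OF assms mt_closed[OF assms]]
  by (intro greatest_LowerI) (simp_all add: Lower_def le_mt_iff, blast)

lemma jn_least:
  assumes "x \<in> carrier H" "y \<in> carrier H"
  shows "least H (jn x y) (Upper H {x, y})"
  using assms jn_closed[OF assms] jn_le_iff[OF assms jn_closed[OF assms]]
  by (intro least_UpperI) (simp_all add: Upper_def jn_le_iff, blast)

lemma im_greatest:
  assumes "x \<in> carrier H" "y \<in> carrier H"
  shows "greatest H (im x y) {z \<in> carrier H. mt x z \<sqsubseteq> y}"
  using im_closed[OF assms] le_im_iff[OF assms] le_im_iff[OF assms im_closed[OF assms], THEN iffD1]
  by (simp add: greatest_def)

lemma bounded_lattice: "bounded_lattice H"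
proof unfold_locales
  show "\<exists>s. least H s (Upper H {x, y})" if "x \<in> carrier H" "y \<in> carrier H" for x y
    using jn_least[OF that] by blast
  show "\<exists>s. greatest H s (Lower H {x, y})" if "x \<in> carrier H" "y \<in> carrier H" for x y
    using mt_greatest[OF that] by blast
  show "\<exists>x. least H x (carrier H)"
    using bt_closed bt_le by (intro exI[of _ bt]) (simp add: least_def)
  show "\<exists>x. greatest H x (carrier H)"
    using tp_closed le_tp by (intro exI[of _ tp]) (simp add: greatest_def)
qed

interpretation bounded_lattice H
  by (rule bounded_lattice)

lemma meet_eq:
  assumes "x \<in> carrier H" "y \<in> carrier H"
  shows "x \<sqinter> y = mt x y"
proof (rule le_antisym)
  have *: "mt x y \<sqsubseteq> x" "mt x y \<sqsubseteq> y"
    using le_mt_iff[OF assms mt_closed[OF assms]] assms mt_closed by simp_all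
  show "mt x y \<sqsubseteq> x \<sqinter> y"
    using * assms mt_closed by (intro meet_le) simp_all
  show "x \<sqinter> y \<sqsubseteq> mt x y"
    using assms le_mt_iff meet_left meet_right by simp
qed (use assms mt_closed in simp_all)

lemma join_eq:
  assumes "x \<in> carrier H" "y \<in> carrier H"
  shows "x \<squnion> y = jn x y"
proof (rule le_antisym)
  have *: "x \<sqsubseteq> jn x y" "y \<sqsubseteq> jn x y"
    using jn_le_iff[OF assms jn_closed[OF assms]] assms jn_closed by simp_all
  show "x \<squnion> y \<sqsubseteq> jn x y"
    using * assms jn_closed by (intro join_le) simp_all
  show "jn x y \<sqsubseteq> x \<squnion> y"
    using assms jn_le_iff join_left join_right by simp
qed (use assms jn_closed in simp_all)

lemma bottom_eq_bt: "\<bottom> = bt"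
  by (rule bottom_eq[symmetric]) (simp_all add: bt_closed bt_le)

lemma top_eq_tp: "\<top> = tp"
  by (rule top_eq[symmetric]) (simp_all add: tp_closed le_tp)

lemma himp_eq:
  assumes "x \<in> carrier H" "y \<in> carrier H"
  shows "himp H x y = im x y"
proof -
  have "{z \<in> carrier H. x \<sqinter> z \<sqsubseteq> y} = {z \<in> carrier H. mt x z \<sqsubseteq> y}"
    using assms meet_eq by (intro Collect_cong) (simp cong: conj_cong)
  then show ?thesis
    unfolding himp_def using im_greatest[OF assms] greatest_unique by (intro the_equality) auto
qed

text \<open>Distributivity is derived: by \<open>le_im_iff\<close>, meeting with \<open>x\<close> is
  left adjoint to \<open>im x\<close>, hence preserves joins. The converse inequality holds in every
  lattice.\<close>

lemma heyting_algebra: "heyting_algebra H"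
proof unfold_locales
  fix x y z assume xyz: "x \<in> carrier H" "y \<in> carrier H" "z \<in> carrier H"
  define w where "w = jn (mt x y) (mt x z)"
  have w: "w \<in> carrier H"
    using xyz by (simp add: w_def mt_closed jn_closed)
  have "mt x y \<sqsubseteq> w" "mt x z \<sqsubseteq> w"
    using jn_le_iff[of "mt x y" "mt x z" w] w xyz by (simp_all add: w_def mt_closed)
  then have "y \<sqsubseteq> im x w" "z \<sqsubseteq> im x w"
    using le_im_iff w xyz by simp_all
  then have "mt x (jn y z) \<sqsubseteq> w"
    using le_im_iff[of x w "jn y z"] jn_le_iff[of y z "im x w"] w xyz
    by (simp add: im_closed jn_closed)
  moreover have "w \<sqsubseteq> mt x (jn y z)"
  proof -
    have *: "mt x u \<sqsubseteq> mt x (jn y z)" if u: "u \<in> carrier H" "u \<sqsubseteq> jn y z" for u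
    proof -
      have "mt x u \<sqsubseteq> x" "mt x u \<sqsubseteq> u"
        using le_mt_iff[of x u "mt x u"] xyz u mt_closed by simp_all
      then show ?thesis
        using le_mt_iff[of x "jn y z" "mt x u"] xyz u mt_closed jn_closed
          le_trans[of "mt x u" u "jn y z"] by simp
    qed
    have "y \<sqsubseteq> jn y z" "z \<sqsubseteq> jn y z"
      using jn_le_iff[of y z "jn y z"] xyz jn_closed by simp_all
    then show ?thesis
      unfolding w_def using * xyz
      by (subst jn_le_iff) (simp_all add: mt_closed jn_closed)
  qed
  ultimately have "mt x (jn y z) = w"
    using w xyz by (intro le_antisym) (simp_all add: mt_closed jn_closed)
  then show "x \<sqinter> (y \<squnion> z) = x \<sqinter> y \<squnion> (x \<sqinter> z)"
    using xyz by (simp add: w_def meet_eq join_eq mt_closed jn_closed)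
next
  fix x y assume xy: "x \<in> carrier H" "y \<in> carrier H"
  have "{z \<in> carrier H. x \<sqinter> z \<sqsubseteq> y} = {z \<in> carrier H. mt x z \<sqsubseteq> y}"
    using xy meet_eq by (intro Collect_cong) (simp cong: conj_cong)
  then show "\<exists>m. greatest H m {z \<in> carrier H. x \<sqinter> z \<sqsubseteq> y}"
    using im_greatest[OF xy] by (intro exI) simp
qed

end

section \<open>Adjunction laws for the official operations\<close>

context heyting_algebra
begin

text \<open>As introduction rules these make classical search diverge.\<close>

declare le_cong_l [rule del] le_cong_r [rule del] weak_refl [rule del]


lemma himp_greatest:
  assumes "x \<in> carrier H" "y \<in> carrier H"
  shows "greatest H (himp H x y) {z \<in> carrier H. x \<sqinter> z \<sqsubseteq> y}"
proof -
  obtain m where m: "greatest H m {z \<in> carrier H. x \<sqinter> z \<sqsubseteq> y}"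
    using imp_exists[OF assms] ..
  show ?thesis
    unfolding himp_def by (rule theI, rule m) (rule greatest_unique[OF _ m])
qed

lemma himp_closed: "\<lbrakk>x \<in> carrier H; y \<in> carrier H\<rbrakk> \<Longrightarrow> himp H x y \<in> carrier H"
  using himp_greatest[of x y] by (simp add: greatest_def)

lemma meet_mono_right:
  assumes "x \<in> carrier H" "y \<in> carrier H" "z \<in> carrier H" "y \<sqsubseteq> z"
  shows "x \<sqinter> y \<sqsubseteq> x \<sqinter> z"
proof (rule meet_le)
  show "x \<sqinter> y \<sqsubseteq> z"
    using assms le_trans[OF meet_right[of x y]] by simp
qed (use assms in \<open>simp_all add: meet_left\<close>)

lemma le_himp_iff:
  assumes "x \<in> carrier H" "y \<in> carrier H" "z \<in> carrier H"
  shows "z \<sqsubseteq> himp H x y \<longleftrightarrow> x \<sqinter> z \<sqsubseteq> y"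
proof
  have *: "x \<sqinter> himp H x y \<sqsubseteq> y"
    using himp_greatest[OF assms(1,2)] by (simp add: greatest_def)
  assume "z \<sqsubseteq> himp H x y"
  with assms show "x \<sqinter> z \<sqsubseteq> y"
    using meet_mono_right[of x z "himp H x y"] * himp_closed
      le_trans[of "x \<sqinter> z" "x \<sqinter> himp H x y" y] by simp
next
  assume "x \<sqinter> z \<sqsubseteq> y"
  then show "z \<sqsubseteq> himp H x y"
    using himp_greatest[OF assms(1,2)] assms(3) by (simp add: greatest_def)
qed

lemma le_meet_iff:
  assumes "x \<in> carrier H" "y \<in> carrier H" "z \<in> carrier H"
  shows "z \<sqsubseteq> x \<sqinter> y \<longleftrightarrow> z \<sqsubseteq> x \<and> z \<sqsubseteq> y"
  using assms le_trans[OF _ meet_left[of x y], of z] le_trans[OF _ meet_right[of x y], of z]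
    meet_le[of z x y] by (intro iffI) simp_all

lemma join_le_iff:
  assumes "x \<in> carrier H" "y \<in> carrier H" "z \<in> carrier H"
  shows "x \<squnion> y \<sqsubseteq> z \<longleftrightarrow> x \<sqsubseteq> z \<and> y \<sqsubseteq> z"
  using assms le_trans[OF join_left[of x y], of z] le_trans[OF join_right[of x y], of z]
    join_le[of x z y] by (intro iffI) simp_all

lemma heyting_op_closed:
  assumes "length xs = fun_ar heyting_lang f" "set xs \<subseteq> carrier H"
  shows "heyting_op H f xs \<in> carrier H"
  using assms
  by (cases f) (simp_all add: heyting_lang_def length_Suc_conv numeral_2_eq_2, auto simp: himp_closed)

end

section \<open>Chains and products as Heyting algebras\<close>

lemma partial_order_gorderI:
  assumes "\<And>x. x \<in> C \<Longrightarrow> l x x"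
    and "\<And>x y. \<lbrakk>x \<in> C; y \<in> C; l x y; l y x\<rbrakk> \<Longrightarrow> x = y"
    and "\<And>x y z. \<lbrakk>x \<in> C; y \<in> C; z \<in> C; l x y; l y z\<rbrakk> \<Longrightarrow> l x z"
  shows "partial_order \<lparr>carrier = C, eq = (=), le = l\<rparr>" (is "partial_order ?H")
proof unfold_locales
  show "x .=\<^bsub>?H\<^esub> y" if "x \<sqsubseteq>\<^bsub>?H\<^esub> y" "y \<sqsubseteq>\<^bsub>?H\<^esub> x" "x \<in> carrier ?H" "y \<in> carrier ?H" for x y
    using that assms(2)[of x y] by simp
  show "x \<sqsubseteq>\<^bsub>?H\<^esub> z" if "x \<sqsubseteq>\<^bsub>?H\<^esub> y" "y \<sqsubseteq>\<^bsub>?H\<^esub> z"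
    "x \<in> carrier ?H" "y \<in> carrier ?H" "z \<in> carrier ?H" for x y z
    using that assms(3)[of x y z] by simp
qed (simp_all add: assms(1))

text \<open>The implication is that of Goedel logic. Pulling the order back along \<open>f\<close>
  covers both the interval [0, 1] and a chain inside \<open>'h\<close>, a type without an order of
  its own.\<close>

lemma heyting_operations_chain:
  fixes f :: "'b \<Rightarrow> 'l::linorder"
  assumes inj: "inj_on f C" and "b \<in> C" "\<And>x. x \<in> C \<Longrightarrow> f b \<le> f x"
    and "c \<in> C" "\<And>x. x \<in> C \<Longrightarrow> f x \<le> f c"
  shows "heyting_operations \<lparr>carrier = C, eq = (=), le = \<lambda>u v. f u \<le> f v\<rparr>
    (\<lambda>u v. if f u \<le> f v then u else v) (\<lambda>u v. if f u \<le> f v then v else u)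
    (\<lambda>u v. if f u \<le> f v then c else v) b c"
proof -
  interpret partial_order "\<lparr>carrier = C, eq = (=), le = \<lambda>u v. f u \<le> f v\<rparr>"
    by (rule partial_order_gorderI) (use inj in \<open>auto dest: inj_onD\<close>)
  show ?thesis
    by unfold_locales (use assms in auto)
qed

text \<open>The order is coordinatewise, so each adjunction splits into those of the factors. The
  encoding \<open>mk\<close> replaces pairs, so that the product can be placed on lists of length
  one.\<close>

lemma heyting_operations_product:
  fixes A :: "'a gorder" and B :: "'b gorder" and mk :: "'a \<Rightarrow> 'b \<Rightarrow> 'c"
  assumes A: "heyting_algebra A" and B: "heyting_algebra B"
    and p: "\<And>a b. \<lbrakk>a \<in> carrier A; b \<in> carrier B\<rbrakk> \<Longrightarrow> p (mk a b) = a"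
    and q: "\<And>a b. \<lbrakk>a \<in> carrier A; b \<in> carrier B\<rbrakk> \<Longrightarrow> q (mk a b) = b"
  shows "heyting_operations
    \<lparr>carrier = {mk a b | a b. a \<in> carrier A \<and> b \<in> carrier B}, eq = (=),
      le = \<lambda>u v. p u \<sqsubseteq>\<^bsub>A\<^esub> p v \<and> q u \<sqsubseteq>\<^bsub>B\<^esub> q v\<rparr>
    (\<lambda>u v. mk (p u \<sqinter>\<^bsub>A\<^esub> p v) (q u \<sqinter>\<^bsub>B\<^esub> q v))
    (\<lambda>u v. mk (p u \<squnion>\<^bsub>A\<^esub> p v) (q u \<squnion>\<^bsub>B\<^esub> q v))
    (\<lambda>u v. mk (himp A (p u) (p v)) (himp B (q u) (q v)))
    (mk \<bottom>\<^bsub>A\<^esub> \<bottom>\<^bsub>B\<^esub>) (mk \<top>\<^bsub>A\<^esub> \<top>\<^bsub>B\<^esub>)" (is "heyting_operations ?L _ _ _ _ _")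
proof -
  interpret A: heyting_algebra A by (rule A)
  interpret B: heyting_algebra B by (rule B)
  interpret partial_order ?L
    by (rule partial_order_gorderI)
      (auto simp: p q intro: A.le_trans B.le_trans
        arg_cong2[where f = mk, OF A.le_antisym B.le_antisym])
  have mk: "\<exists>a' b'. mk a b = mk a' b' \<and> a' \<in> carrier A \<and> b' \<in> carrier B"
    if "a \<in> carrier A" "b \<in> carrier B" for a b
    using that by blast
  show ?thesis
    by unfold_locales
      (auto intro!: mk simp: p q A.himp_closed B.himp_closed A.le_meet_iff B.le_meet_iff A.join_le_iff
        B.join_le_iff A.le_himp_iff B.le_himp_iff)
qed


section \<open>Evaluation of one-variable terms\<close>

definition hval :: "('a, 'b) gorder_scheme \<Rightarrow> 'a \<Rightarrow> heyting_term \<Rightarrow> 'a" where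
  "hval H x t = tm_val (heyting_struct H) (\<lambda>_. x) t"

lemma hval_simps [simp]:
  "hval H x (Var i) = x"
  "hval H x (Fn Meet [s, t]) = hval H x s \<sqinter>\<^bsub>H\<^esub> hval H x t"
  "hval H x (Fn Join [s, t]) = hval H x s \<squnion>\<^bsub>H\<^esub> hval H x t"
  "hval H x (Fn Imp [s, t]) = himp H (hval H x s) (hval H x t)"
  "hval H x (Fn Bot []) = \<bottom>\<^bsub>H\<^esub>"
  "hval H x (Fn Top []) = \<top>\<^bsub>H\<^esub>"
  by (simp_all add: hval_def heyting_struct_def)

lemma mem_solution_set_iff: "x \<in> solution_set H t \<longleftrightarrow> x \<in> carrier H \<and> hval H x t = \<top>\<^bsub>H\<^esub>"
  by (simp add: solution_set_def eq_top_def hval_def heyting_struct_def)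

text \<open>Well-formedness excludes symbols with a wrong number of arguments, on which
  \<open>heyting_op\<close> is \<open>undefined\<close>; only five shapes and the variables
  remain.\<close>

lemma wf_heyting_term_induct [consumes 1, case_names Var Meet Join Imp Bot Top]:
  assumes "wf_tm heyting_lang t"
    and "\<And>i. P (Var i)"
    and "\<And>s t. \<lbrakk>wf_tm heyting_lang s; wf_tm heyting_lang t; P s; P t\<rbrakk> \<Longrightarrow>
      P (Fn Meet [s, t])"
    and "\<And>s t. \<lbrakk>wf_tm heyting_lang s; wf_tm heyting_lang t; P s; P t\<rbrakk> \<Longrightarrow>
      P (Fn Join [s, t])"
    and "\<And>s t. \<lbrakk>wf_tm heyting_lang s; wf_tm heyting_lang t; P s; P t\<rbrakk> \<Longrightarrow>
      P (Fn Imp [s, t])"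
    and "P (Fn Bot [])" "P (Fn Top [])"
  shows "P t"
  using assms(1)
proof (induction t)
  case (Fn f ts)
  have P: "P s" if "s \<in> set ts" for s
    using Fn that by auto
  show ?case
  proof (cases "f = Bot \<or> f = Top")
    case True
    then show ?thesis
      using Fn.prems assms(6,7) by (auto simp: heyting_lang_def)
  next
    case False
    then have "length ts = 2"
      using Fn.prems by (cases f) (auto simp: heyting_lang_def)
    then obtain s t where "ts = [s, t]"
      by (auto simp: length_Suc_conv numeral_2_eq_2)
    then show ?thesis
      using P False assms(3-5) Fn.prems by (cases f) auto
  qed
qed (rule assms(2))

lemma (in heyting_algebra) hval_closed:
  "\<lbrakk>wf_tm heyting_lang t; x \<in> carrier H\<rbrakk> \<Longrightarrow> hval H x t \<in> carrier H"
  by (induction t rule: wf_heyting_term_induct) (auto simp: himp_closed)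

text \<open>Used for the embedding of a three-element chain into [0, 1] and for the two projections
  of the product.\<close>

lemma hval_hom:
  assumes "heyting_algebra G" "wf_tm heyting_lang t" "x \<in> carrier G"
    and "\<And>u v. \<lbrakk>u \<in> carrier G; v \<in> carrier G\<rbrakk> \<Longrightarrow> f (u \<sqinter>\<^bsub>G\<^esub> v) = f u \<sqinter>\<^bsub>H\<^esub> f v"
    and "\<And>u v. \<lbrakk>u \<in> carrier G; v \<in> carrier G\<rbrakk> \<Longrightarrow> f (u \<squnion>\<^bsub>G\<^esub> v) = f u \<squnion>\<^bsub>H\<^esub> f v"
    and "\<And>u v. \<lbrakk>u \<in> carrier G; v \<in> carrier G\<rbrakk> \<Longrightarrow> f (himp G u v) = himp H (f u) (f v)"
    and "f \<bottom>\<^bsub>G\<^esub> = \<bottom>\<^bsub>H\<^esub>" "f \<top>\<^bsub>G\<^esub> = \<top>\<^bsub>H\<^esub>"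
  shows "hval H (f x) t = f (hval G x t)"
proof -
  interpret heyting_algebra G by fact
  show ?thesis
    using assms(2) by (induction t rule: wf_heyting_term_induct) (auto simp: assms(3-) hval_closed)
qed

section \<open>The finite model property\<close>

fun subterms :: "'f tm \<Rightarrow> 'f tm set" where
  "subterms (Var i) = {Var i}"
| "subterms (Fn f ts) = insert (Fn f ts) (\<Union>t\<in>set ts. subterms t)"

lemma finite_subterms [simp]: "finite (subterms t)"
  by (induction t) auto

lemma self_mem_subterms [simp]: "t \<in> subterms t"
  by (cases t) auto

lemma wf_subterms: "\<lbrakk>wf_tm \<L> t; s \<in> subterms t\<rbrakk> \<Longrightarrow> wf_tm \<L> s"
  by (induction t) auto

section \<open>Sublattices generated by finitely many elements\<close>

locale bounded_sublattice = heyting_algebra H for H (structure) +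
  fixes D
  assumes sub: "D \<subseteq> carrier H"
    and bottom_mem: "\<bottom> \<in> D"
    and top_mem: "\<top> \<in> D"
    and meet_mem: "\<lbrakk>x \<in> D; y \<in> D\<rbrakk> \<Longrightarrow> x \<sqinter> y \<in> D"
    and join_mem: "\<lbrakk>x \<in> D; y \<in> D\<rbrakk> \<Longrightarrow> x \<squnion> y \<in> D"

context heyting_algebra
begin

lemma top_meet_eq: "x \<in> carrier H \<Longrightarrow> \<top> \<sqinter> x = x"
  using top_meet by (simp add: eq_is_equal)

lemma bottom_meet_eq: "x \<in> carrier H \<Longrightarrow> \<bottom> \<sqinter> x = \<bottom>"
  using bottom_meet by (simp add: eq_is_equal)

lemma bottom_join_eq: "x \<in> carrier H \<Longrightarrow> \<bottom> \<squnion> x = x"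
  using bottom_join by (simp add: eq_is_equal)

lemma top_join_eq: "x \<in> carrier H \<Longrightarrow> \<top> \<squnion> x = \<top>"
  using top_join by (simp add: eq_is_equal)

lemma meet_assoc: "\<lbrakk>x \<in> carrier H; y \<in> carrier H; z \<in> carrier H\<rbrakk> \<Longrightarrow> x \<sqinter> y \<sqinter> z = x \<sqinter> (y \<sqinter> z)"
  using weak_meet_assoc by (simp add: eq_is_equal)

lemma join_assoc: "\<lbrakk>x \<in> carrier H; y \<in> carrier H; z \<in> carrier H\<rbrakk> \<Longrightarrow> x \<squnion> y \<squnion> z = x \<squnion> (y \<squnion> z)"
  using weak_join_assoc by (simp add: eq_is_equal)

lemma meet_left_comm:
  "\<lbrakk>x \<in> carrier H; y \<in> carrier H; z \<in> carrier H\<rbrakk> \<Longrightarrow> x \<sqinter> (y \<sqinter> z) = y \<sqinter> (x \<sqinter> z)"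
  using meet_assoc meet_comm by metis

lemma join_left_comm:
  "\<lbrakk>x \<in> carrier H; y \<in> carrier H; z \<in> carrier H\<rbrakk> \<Longrightarrow> x \<squnion> (y \<squnion> z) = y \<squnion> (x \<squnion> z)"
  using join_assoc join_comm by metis

lemma meet_idem: "x \<in> carrier H \<Longrightarrow> x \<sqinter> x = x"
  using le_iff_join[of x x] by simp

lemma distrib_right:
  "\<lbrakk>x \<in> carrier H; y \<in> carrier H; z \<in> carrier H\<rbrakk> \<Longrightarrow> (y \<squnion> z) \<sqinter> x = (y \<sqinter> x) \<squnion> (z \<sqinter> x)"
  using distrib[of x y z] by (simp add: meet_comm)

text \<open>In a distributive lattice every lattice polynomial in \<open>s\<close> with coefficients
  in \<open>D\<close> has the normal form a \<squnion> (b \<sqinter> s), so these elements form the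
  sublattice generated by \<open>D\<close> and \<open>s\<close>.\<close>

lemma bounded_sublattice_insert:
  assumes "bounded_sublattice H D" and s: "s \<in> carrier H"
  shows "bounded_sublattice H {a \<squnion> (b \<sqinter> s) | a b. a \<in> D \<and> b \<in> D}" (is "bounded_sublattice H ?E")
    and "insert s D \<subseteq> {a \<squnion> (b \<sqinter> s) | a b. a \<in> D \<and> b \<in> D}"
proof -
  interpret bounded_sublattice H D by fact
  have D: "a \<in> carrier H" if "a \<in> D" for a
    using that sub by (rule subsetD[rotated])
  have E: "a \<squnion> (b \<sqinter> s) \<in> ?E" if "a \<in> D" "b \<in> D" for a b
    using that by blast
  show ins: "insert s D \<subseteq> ?E"
  proof
    fix x assume "x \<in> insert s D"
    then consider "x = s" | "x \<in> D" by blast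
    then show "x \<in> ?E"
    proof cases
      case 1
      then have "x = \<bottom> \<squnion> (\<top> \<sqinter> s)"
        using s by (simp add: top_meet_eq bottom_join_eq)
      then show ?thesis
        using E[OF bottom_mem top_mem] by (rule ssubst)
    next
      case 2
      then have "x = x \<squnion> (\<bottom> \<sqinter> s)"
        using s D bottom_join_eq join_comm[of H x \<bottom>] by (simp add: bottom_meet_eq)
      then show ?thesis
        using E[OF 2 bottom_mem] by (rule ssubst)
    qed
  qed
  show "bounded_sublattice H ?E"
  proof unfold_locales
    show "?E \<subseteq> carrier H"
      using D s by clarsimp
    show "\<bottom> \<in> ?E" "\<top> \<in> ?E"
      using subsetD[OF ins] bottom_mem top_mem by simp_all
  next
    fix x y assume "x \<in> ?E" "y \<in> ?E"
    then obtain a b c d where ab: "a \<in> D" "b \<in> D" "c \<in> D" "d \<in> D"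
      and x: "x = a \<squnion> (b \<sqinter> s)" and y: "y = c \<squnion> (d \<sqinter> s)"
      by blast
    have cl: "a \<in> carrier H" "b \<in> carrier H" "c \<in> carrier H" "d \<in> carrier H"
      using ab D by simp_all
    have "x \<squnion> y = (a \<squnion> c) \<squnion> ((b \<squnion> d) \<sqinter> s)"
      unfolding x y using s cl
      by (simp add: distrib_right join_assoc join_left_comm)
    then show "x \<squnion> y \<in> ?E"
      by (rule ssubst) (intro E join_mem ab)
    \<comment> \<open>The meet of two normal forms expands into one term free of \<open>s\<close>
      and three terms with a factor \<open>s\<close>, which are collected into a single
      coefficient.\<close>
    have "a \<sqinter> (d \<sqinter> s) = a \<sqinter> d \<sqinter> s"
      using s cl by (simp add: meet_assoc)
    moreover have "b \<sqinter> s \<sqinter> c = b \<sqinter> c \<sqinter> s"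
      using s cl by (simp add: meet_assoc meet_comm[of H s c])
    moreover have "b \<sqinter> s \<sqinter> (d \<sqinter> s) = b \<sqinter> d \<sqinter> s"
      using s cl by (simp add: meet_assoc meet_left_comm[of s d s] meet_idem)
    ultimately have "x \<sqinter> y = (a \<sqinter> c) \<squnion> (((b \<sqinter> c) \<squnion> ((a \<sqinter> d) \<squnion> (b \<sqinter> d))) \<sqinter> s)"
      unfolding x y using s cl
      by (simp add: distrib distrib_right join_assoc)
    then show "x \<sqinter> y \<in> ?E"
      by (rule ssubst) (intro E join_mem meet_mem ab)
  qed
qed

text \<open>Local finiteness of bounded distributive lattices: starting from {\<bottom>, \<top>},
  each adjoined generator at most squares the number of elements.\<close>

lemma finite_bounded_sublattice_superset:
  assumes "finite S" "S \<subseteq> carrier H"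
  shows "\<exists>D. finite D \<and> S \<subseteq> D \<and> bounded_sublattice H D"
  using assms
proof (induction rule: finite_induct)
  case empty
  have "bounded_sublattice H {\<bottom>, \<top>}"
  proof unfold_locales
    fix x y assume "x \<in> {\<bottom>, \<top>}" "y \<in> {\<bottom>, \<top>}"
    then show "x \<sqinter> y \<in> {\<bottom>, \<top>}" "x \<squnion> y \<in> {\<bottom>, \<top>}"
      by (elim insertE emptyE; simp add: bottom_meet_eq top_meet_eq bottom_join_eq top_join_eq)+
  qed simp_all
  then show ?case
    by (intro exI[of _ "{\<bottom>, \<top>}"]) simp
next
  case (insert s S)
  have "S \<subseteq> carrier H"
    using insert.prems by simp
  from insert.IH[OF this] obtain D where D: "finite D" "S \<subseteq> D" "bounded_sublattice H D"
    by (elim exE conjE)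
  let ?E = "{a \<squnion> (b \<sqinter> s) | a b. a \<in> D \<and> b \<in> D}"
  have "finite ?E"
    by (intro finite_image_set2) (simp_all add: D(1))
  moreover have "s \<in> carrier H"
    using insert.prems by simp
  note bounded_sublattice_insert[OF D(3) this]
  moreover have "insert s S \<subseteq> ?E"
    using insert_mono[OF D(2)] calculation(3) by (rule order_trans)
  ultimately show ?case
    by (intro exI conjI)
qed

end

text \<open>
  The implication \<open>x \<Rightarrow> y\<close> of the sublattice is the join of the finitely many \<open>z\<close> with
  \<open>x \<sqinter> z \<sqsubseteq> y\<close>; it may lie strictly below the implication of the ambient algebra.
\<close>

lemma (in bounded_sublattice) finite_imp_exists:
  assumes fin: "finite D" and xy: "x \<in> D" "y \<in> D"
  shows "\<exists>m\<in>D. \<forall>z\<in>D. z \<sqsubseteq> m \<longleftrightarrow> x \<sqinter> z \<sqsubseteq> y"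
proof -
  have D: "a \<in> carrier H" if "a \<in> D" for a
    using that sub by (rule subsetD[rotated])
  \<comment> \<open>Joins of finite subsets, given by their universal property against all of
    \<open>H\<close>, so that \<open>m\<close> can be compared with elements outside
    \<open>D\<close>.\<close>
  have lub: "\<exists>m\<in>D. \<forall>z\<in>carrier H. m \<sqsubseteq> z \<longleftrightarrow> (\<forall>a\<in>A. a \<sqsubseteq> z)" if "finite A" "A \<subseteq> D" for A
    using that
  proof (induction rule: finite_induct)
    case empty
    then show ?case
      using bottom_mem by (intro bexI[of _ \<bottom>]) simp_all
  next
    case (insert a A)
    then obtain m where m: "m \<in> D" "\<forall>z\<in>carrier H. m \<sqsubseteq> z \<longleftrightarrow> (\<forall>a\<in>A. a \<sqsubseteq> z)"
      by simp blast
    show ?case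
      using m insert.prems D by (intro bexI[of _ "a \<squnion> m"]) (simp_all add: join_le_iff join_mem)
  qed
  define A where "A = {z \<in> D. x \<sqinter> z \<sqsubseteq> y}"
  have A: "A \<subseteq> D" "finite A"
    using fin by (simp_all add: A_def)
  obtain m where m: "m \<in> D" "\<forall>z\<in>carrier H. m \<sqsubseteq> z \<longleftrightarrow> (\<forall>a\<in>A. a \<sqsubseteq> z)"
    using lub[OF A(2,1)] by blast
  have cl: "x \<in> carrier H" "y \<in> carrier H" "m \<in> carrier H"
    using xy m D by simp_all
  \<comment> \<open>The ambient implication bounds every member of \<open>A\<close>, hence also
    their join. This replaces distributing \<open>x\<close> over a finite join.\<close>
  have "m \<sqsubseteq> himp H x y"
    using m(2)[rule_format, OF himp_closed[OF cl(1,2)]] cl D by (simp add: A_def le_himp_iff)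
  moreover have "a \<sqsubseteq> m" if "a \<in> A" for a
    using m(2)[rule_format, OF cl(3)] le_refl[OF cl(3)] that by simp
  ultimately have "z \<sqsubseteq> m \<longleftrightarrow> x \<sqinter> z \<sqsubseteq> y" if "z \<in> D" for z
    using that cl D[OF that] le_trans[of z m "himp H x y"]
    by (intro iffI) (simp_all add: himp_closed le_himp_iff A_def)
  then show ?thesis
    using m(1) by blast
qed

text \<open>The second conclusion holds because the ambient implication, once it lies in
  \<open>D\<close>, is also the greatest candidate inside \<open>D\<close>.\<close>

lemma (in bounded_sublattice) heyting_operations_finite:
  assumes fin: "finite D"
  obtains im where "heyting_operations \<lparr>carrier = D, eq = (=), le = le H\<rparr> (\<sqinter>) (\<squnion>) im \<bottom> \<top>"
    and "\<And>x y. \<lbrakk>x \<in> D; y \<in> D; himp H x y \<in> D\<rbrakk> \<Longrightarrow> im x y = himp H x y"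
proof -
  have D: "a \<in> carrier H" if "a \<in> D" for a
    using that sub by (rule subsetD[rotated])
  define im where "im x y = (SOME m. m \<in> D \<and> (\<forall>z\<in>D. z \<sqsubseteq> m \<longleftrightarrow> x \<sqinter> z \<sqsubseteq> y))" for x y
  have "im x y \<in> D \<and> (\<forall>z\<in>D. z \<sqsubseteq> im x y \<longleftrightarrow> x \<sqinter> z \<sqsubseteq> y)" if "x \<in> D" "y \<in> D" for x y
    unfolding im_def using finite_imp_exists[OF fin that, unfolded Bex_def] by (rule someI_ex)
  then have im: "im x y \<in> D" and le_im: "z \<in> D \<Longrightarrow> z \<sqsubseteq> im x y \<longleftrightarrow> x \<sqinter> z \<sqsubseteq> y"
    if "x \<in> D" "y \<in> D" for x y z
    using that by simp_all
  show thesis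
  proof
    interpret D: partial_order "\<lparr>carrier = D, eq = (=), le = le H\<rparr>"
    proof (rule partial_order_gorderI)
      show "x = y" if "x \<in> D" "y \<in> D" "x \<sqsubseteq> y" "y \<sqsubseteq> x" for x y
        using that(3,4) D[OF that(1)] D[OF that(2)] by (rule le_antisym)
      show "x \<sqsubseteq> z" if "x \<in> D" "y \<in> D" "z \<in> D" "x \<sqsubseteq> y" "y \<sqsubseteq> z" for x y z
        using that(4,5) D[OF that(1)] D[OF that(2)] D[OF that(3)] by (rule le_trans)
    qed (simp add: D)
    show "heyting_operations \<lparr>carrier = D, eq = (=), le = le H\<rparr> (\<sqinter>) (\<squnion>) im \<bottom> \<top>"
      by unfold_locales
        (simp_all add: D meet_mem join_mem bottom_mem top_mem im le_im le_meet_iff join_le_iff)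
    show "im x y = himp H x y" if "x \<in> D" "y \<in> D" "himp H x y \<in> D" for x y
    proof (rule le_antisym)
      have cl: "x \<in> carrier H" "y \<in> carrier H" "im x y \<in> carrier H"
        using that im D by simp_all
      have "x \<sqinter> im x y \<sqsubseteq> y"
        using le_im[of x y "im x y"] that im cl by simp
      then show "im x y \<sqsubseteq> himp H x y"
        using cl by (simp add: le_himp_iff)
      have "x \<sqinter> himp H x y \<sqsubseteq> y"
        using le_himp_iff[of x y "himp H x y"] cl by (simp add: himp_closed)
      then show "himp H x y \<sqsubseteq> im x y"
        using that by (simp add: le_im)
    qed (use that im D in simp_all)
  qed
qed

text \<open>Each implication met during the evaluation is the value of a subterm, so its ambient
  value lies in \<open>D\<close>, where both implications agree.\<close>

lemma (in bounded_sublattice) hval_sublattice: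
  assumes ops: "heyting_operations \<lparr>carrier = D, eq = (=), le = le H\<rparr> (\<sqinter>) (\<squnion>) im \<bottom> \<top>"
    and im: "\<And>x y. \<lbrakk>x \<in> D; y \<in> D; himp H x y \<in> D\<rbrakk> \<Longrightarrow> im x y = himp H x y"
    and "wf_tm heyting_lang t" "hval H x ` subterms t \<subseteq> D"
  shows "hval \<lparr>carrier = D, eq = (=), le = le H\<rparr> x t = hval H x t"
  using assms(3,4)
proof (induction t rule: wf_heyting_term_induct)
  case (Meet s t)
  then have "hval H x s \<in> D" "hval H x t \<in> D"
    using self_mem_subterms by (simp_all add: image_subset_iff)
  with Meet show ?case
    using heyting_operations.meet_eq[OF ops, of "hval H x s" "hval H x t"] by (simp add: image_Un)
next
  case (Join s t)
  then have "hval H x s \<in> D" "hval H x t \<in> D"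
    using self_mem_subterms by (simp_all add: image_subset_iff)
  with Join show ?case
    using heyting_operations.join_eq[OF ops, of "hval H x s" "hval H x t"] by (simp add: image_Un)
next
  case (Imp s t)
  then have "hval H x s \<in> D" "hval H x t \<in> D"
    using self_mem_subterms by (simp_all add: image_subset_iff)
  with Imp show ?case
    using heyting_operations.himp_eq[OF ops, of "hval H x s" "hval H x t"]
      im[of "hval H x s" "hval H x t"] by (simp add: image_Un)
qed (simp_all add: heyting_operations.bottom_eq_bt[OF ops] heyting_operations.top_eq_tp[OF ops])

text \<open>The finite algebra stays in the type of \<open>H\<close>, so that hypotheses about
  algebras on that type remain applicable to it.\<close>

lemma finite_model_property:
  fixes H :: "'a gorder"
  assumes H: "heyting_algebra H" and t: "wf_tm heyting_lang t"
    and x: "x \<in> carrier H" "hval H x t \<noteq> \<top>\<^bsub>H\<^esub>"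
  obtains G :: "'a gorder" where "heyting_algebra G" "finite (carrier G)"
    "x \<in> carrier G" "hval G x t \<noteq> \<top>\<^bsub>G\<^esub>"
proof -
  interpret heyting_algebra H by fact
  \<comment> \<open>The point \<open>x\<close> is added separately: if no variable occurs in
    \<open>t\<close>, it need not be the value of a subterm.\<close>
  define S where "S = insert x (hval H x ` subterms t)"
  have "finite S"
    by (simp add: S_def)
  moreover have "S \<subseteq> carrier H"
    using hval_closed[OF wf_subterms[OF t] x(1)] x(1) by (simp add: S_def image_subset_iff)
  ultimately obtain D where D: "finite D" "S \<subseteq> D" and sub: "bounded_sublattice H D"
    by (rule finite_bounded_sublattice_superset[THEN exE]) (elim conjE)
  let ?G = "\<lparr>carrier = D, eq = (=), le = le H\<rparr>"
  obtain im where im: "heyting_operations ?G (meet H) (join H) im \<bottom>\<^bsub>H\<^esub> \<top>\<^bsub>H\<^esub>"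
    and im_eq: "\<And>x y. \<lbrakk>x \<in> D; y \<in> D; himp H x y \<in> D\<rbrakk> \<Longrightarrow> im x y = himp H x y"
    using bounded_sublattice.heyting_operations_finite[OF sub D(1)] by blast
  show thesis
  proof (rule that)
    show "heyting_algebra ?G"
      using im by (rule heyting_operations.heyting_algebra)
    have "hval H x ` subterms t \<subseteq> D"
      using D(2) by (simp add: S_def)
    then have "hval ?G x t = hval H x t"
      by (intro bounded_sublattice.hval_sublattice[OF sub im _ t] im_eq)
    then show "hval ?G x t \<noteq> \<top>\<^bsub>?G\<^esub>"
      using x(2) heyting_operations.top_eq_tp[OF im] by simp
  qed (use D in \<open>simp_all add: S_def\<close>)
qed

section \<open>Heyting algebras as first-order structures\<close>

lemma heyting_struct_simps [simp]:
  "univ (heyting_struct H) = carrier H"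
  "fun_int (heyting_struct H) = heyting_op H"
  "rel_int (heyting_struct H) Le xs \<longleftrightarrow> xs ! 0 \<sqsubseteq>\<^bsub>H\<^esub> xs ! 1"
  by (simp_all add: heyting_struct_def)

context heyting_algebra
begin

lemma is_struct_heyting: "is_struct heyting_lang (heyting_struct H)"
  using heyting_op_closed bottom_closed unfolding is_struct_def by force

lemma models_heyting_theory: "models (heyting_struct H) heyting_theory"
proof -
  have *: "x \<sqsubseteq> x" "x \<sqinter> y \<sqsubseteq> x" "x \<sqinter> y \<sqsubseteq> y" "x \<sqsubseteq> x \<squnion> y" "y \<sqsubseteq> x \<squnion> y" "\<bottom> \<sqsubseteq> x" "x \<sqsubseteq> \<top>"
    "x \<sqinter> (y \<squnion> z) = x \<sqinter> y \<squnion> x \<sqinter> z" "x \<sqinter> himp H x y \<sqsubseteq> y"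
    if "x \<in> carrier H" "y \<in> carrier H" "z \<in> carrier H" for x y z
    using that le_himp_iff[of x y "himp H x y"]
    by (simp_all add: meet_left meet_right join_left join_right distrib himp_closed)
  have antisym: "\<forall>x\<in>carrier H. \<forall>y\<in>carrier H. x \<sqsubseteq> y \<and> y \<sqsubseteq> x \<longrightarrow> x = y"
    by (intro ballI impI) (elim conjE, rule le_antisym)
  have trans: "\<forall>x\<in>carrier H. \<forall>y\<in>carrier H. \<forall>z\<in>carrier H. x \<sqsubseteq> y \<and> y \<sqsubseteq> z \<longrightarrow> x \<sqsubseteq> z"
    by (intro ballI impI) (elim conjE, rule le_trans)
  from * show ?thesis
    unfolding models_def heyting_theory_def Let_def
    by (simp add: le_meet_iff join_le_iff le_himp_iff) (intro conjI impI antisym trans)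
qed

end


section \<open>Sets definable from the ordered field structure\<close>

locale ordered_field_expansion =
  fixes \<L> :: "('f, 'r) lang"
    and R :: "('f, 'r, 'a::linordered_field) fo_struct"
  assumes expands: "expands_ordered_field \<L> R"
begin

text \<open>Terms and formulas seen through their semantics: the closure rules below prove
  definability from the logical shape of a predicate on assignments, without building
  syntax.\<close>

definition def_tm :: "((nat \<Rightarrow> 'a) \<Rightarrow> 'a) \<Rightarrow> bool" where
  "def_tm g \<longleftrightarrow> (\<exists>s. wf_tm \<L> s \<and> (\<forall>\<sigma>. tm_val R \<sigma> s = g \<sigma>))"

definition def_pred :: "((nat \<Rightarrow> 'a) \<Rightarrow> bool) \<Rightarrow> bool" where
  "def_pred P \<longleftrightarrow> (\<exists>\<phi>. wf_fm \<L> \<phi> \<and> (\<forall>\<sigma>. sat R \<sigma> \<phi> \<longleftrightarrow> P \<sigma>))"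

lemma univ_eq: "univ R = UNIV"
  using expands by (simp add: expands_ordered_field_def)

lemma def_tm_var: "def_tm (\<lambda>\<sigma>. \<sigma> i)"
  unfolding def_tm_def by (intro exI[of _ "Var i"]) simp

lemma def_tm_zero: "def_tm (\<lambda>\<sigma>. 0)"
proof -
  obtain f where "fun_ar \<L> f = 0" "fun_int R f [] = 0"
    using expands by (auto simp: expands_ordered_field_def)
  then show ?thesis
    unfolding def_tm_def by (intro exI[of _ "Fn f []"]) simp
qed

lemma def_tm_one: "def_tm (\<lambda>\<sigma>. 1)"
proof -
  obtain f where "fun_ar \<L> f = 0" "fun_int R f [] = 1"
    using expands by (auto simp: expands_ordered_field_def)
  then show ?thesis
    unfolding def_tm_def by (intro exI[of _ "Fn f []"]) simp
qed

lemma def_tm_add: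
  assumes "def_tm g" "def_tm h"
  shows "def_tm (\<lambda>\<sigma>. g \<sigma> + h \<sigma>)"
proof -
  obtain f where f: "fun_ar \<L> f = 2" "\<And>x y. fun_int R f [x, y] = x + y"
    using expands unfolding expands_ordered_field_def by blast
  obtain s t where "wf_tm \<L> s" "\<forall>\<sigma>. tm_val R \<sigma> s = g \<sigma>" "wf_tm \<L> t" "\<forall>\<sigma>. tm_val R \<sigma> t = h \<sigma>"
    using assms by (auto simp: def_tm_def)
  with f show ?thesis
    unfolding def_tm_def by (intro exI[of _ "Fn f [s, t]"]) simp
qed

lemma def_tm_of_nat: "def_tm (\<lambda>\<sigma>. of_nat k)"
  by (induction k) (simp_all add: def_tm_zero def_tm_one def_tm_add)

lemma def_pred_less:
  assumes "def_tm g" "def_tm h"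
  shows "def_pred (\<lambda>\<sigma>. g \<sigma> < h \<sigma>)"
proof -
  obtain r where r: "rel_ar \<L> r = 2" "\<And>x y. rel_int R r [x, y] \<longleftrightarrow> x < y"
    using expands unfolding expands_ordered_field_def by blast
  obtain s t where "wf_tm \<L> s" "\<forall>\<sigma>. tm_val R \<sigma> s = g \<sigma>" "wf_tm \<L> t" "\<forall>\<sigma>. tm_val R \<sigma> t = h \<sigma>"
    using assms by (auto simp: def_tm_def)
  with r show ?thesis
    unfolding def_pred_def by (intro exI[of _ "FRel r [s, t]"]) simp
qed

lemma def_pred_not:
  assumes "def_pred P"
  shows "def_pred (\<lambda>\<sigma>. \<not> P \<sigma>)"
proof -
  obtain \<phi> where "wf_fm \<L> \<phi>" "\<forall>\<sigma>. sat R \<sigma> \<phi> \<longleftrightarrow> P \<sigma>"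
    using assms by (auto simp: def_pred_def)
  then show ?thesis
    unfolding def_pred_def by (intro exI[of _ "FNot \<phi>"]) simp
qed

lemma def_pred_conj:
  assumes "def_pred P" "def_pred Q"
  shows "def_pred (\<lambda>\<sigma>. P \<sigma> \<and> Q \<sigma>)"
proof -
  obtain \<phi> \<psi> where "wf_fm \<L> \<phi>" "\<forall>\<sigma>. sat R \<sigma> \<phi> \<longleftrightarrow> P \<sigma>" "wf_fm \<L> \<psi>" "\<forall>\<sigma>. sat R \<sigma> \<psi> \<longleftrightarrow> Q \<sigma>"
    using assms by (auto simp: def_pred_def)
  then show ?thesis
    unfolding def_pred_def by (intro exI[of _ "FAnd \<phi> \<psi>"]) simp
qed

lemma def_pred_disj: "\<lbrakk>def_pred P; def_pred Q\<rbrakk> \<Longrightarrow> def_pred (\<lambda>\<sigma>. P \<sigma> \<or> Q \<sigma>)"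
  using def_pred_not[OF def_pred_conj[OF def_pred_not def_pred_not, of P Q]]
  by (simp only: de_Morgan_conj not_not)

lemma def_pred_imp: "\<lbrakk>def_pred P; def_pred Q\<rbrakk> \<Longrightarrow> def_pred (\<lambda>\<sigma>. P \<sigma> \<longrightarrow> Q \<sigma>)"
  using def_pred_disj[OF def_pred_not, of P Q] by (simp only: imp_conv_disj)

lemma def_pred_iff: "\<lbrakk>def_pred P; def_pred Q\<rbrakk> \<Longrightarrow> def_pred (\<lambda>\<sigma>. P \<sigma> \<longleftrightarrow> Q \<sigma>)"
  using def_pred_conj[OF def_pred_imp def_pred_imp, of P Q Q P]
  by (simp only: iff_conv_conj_imp)

lemma def_pred_le: "\<lbrakk>def_tm g; def_tm h\<rbrakk> \<Longrightarrow> def_pred (\<lambda>\<sigma>. g \<sigma> \<le> h \<sigma>)"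
  using def_pred_not[OF def_pred_less[of h g]] by (simp only: not_less)

lemma def_pred_all:
  assumes "def_pred P"
  shows "def_pred (\<lambda>\<sigma>. \<forall>a. P (\<sigma>(i := a)))"
proof -
  obtain \<phi> where "wf_fm \<L> \<phi>" "\<forall>\<sigma>. sat R \<sigma> \<phi> \<longleftrightarrow> P \<sigma>"
    using assms by (auto simp: def_pred_def)
  then show ?thesis
    unfolding def_pred_def by (intro exI[of _ "FAll i \<phi>"]) (simp add: univ_eq)
qed

lemma def_pred_const: "def_pred (\<lambda>\<sigma>. b)"
  using def_pred_less[OF def_tm_zero def_tm_one] def_pred_less[OF def_tm_zero def_tm_zero]
  by (cases b) simp_all

text \<open>The index set may lie outside \<open>R\<close>; the quantifier becomes a finite
  disjunction. It serves for the elements of \<open>D\<close>.\<close>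

lemma def_pred_bex:
  assumes "finite A" "\<And>a. a \<in> A \<Longrightarrow> def_pred (P a)"
  shows "def_pred (\<lambda>\<sigma>. \<exists>a\<in>A. P a \<sigma>)"
  using assms by (induction rule: finite_induct) (simp_all add: def_pred_const def_pred_disj)

lemmas def_pred_intros = def_pred_all def_pred_iff def_pred_imp def_pred_conj

text \<open>All parameters are set to 0; the predicates supplied later depend only on the
  coordinates below \<open>n\<close>.\<close>

lemma definableI:
  assumes "def_pred P"
    and "\<And>xs. xs \<in> X \<longleftrightarrow> length xs = n \<and> P (\<lambda>i. if i < n then xs ! i else 0)"
  shows "definable \<L> R n X"
proof -
  obtain \<phi> where "wf_fm \<L> \<phi>" "\<forall>\<sigma>. sat R \<sigma> \<phi> \<longleftrightarrow> P \<sigma>"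
    using assms(1) by (auto simp: def_pred_def)
  with assms(2) show ?thesis
    unfolding definable_def univ_eq by (intro exI[of _ \<phi>] exI[of _ "\<lambda>_. 0"]) auto
qed

lemma definable_singleton: "definable \<L> R 1 {[c]}"
  unfolding definable_def univ_eq
  \<comment> \<open>\<open>Var 1\<close> is not a coordinate of the line, so it acts as a parameter
    with value \<open>c\<close>.\<close>
  by (intro exI[of _ "FEq (Var 0) (Var 1)"] exI[of _ "\<lambda>_. c"]) (auto simp: length_Suc_conv)

end


section \<open>Definable Heyting algebras on the line\<close>

text \<open>The order, restricted to the carrier, is the only relation to be defined by hand. Its
  reflexive points are the carrier, and quantification over the line then defines the
  operations.\<close>

locale definable_heyting_line = ordered_field_expansion \<L> R + heyting_algebra H
  for \<L> :: "('f, 'r) lang" and R :: "('f, 'r, 'a::linordered_field) fo_struct"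
    and H :: "'a list gorder" (structure) +
  assumes length_carrier: "x \<in> carrier H \<Longrightarrow> length x = 1"
    and def_le: "def_pred (\<lambda>\<sigma>. [\<sigma> i] \<in> carrier H \<and> [\<sigma> j] \<in> carrier H \<and> [\<sigma> i] \<sqsubseteq> [\<sigma> j])"
begin

definition le_line :: "'a \<Rightarrow> 'a \<Rightarrow> bool" where
  "le_line x y \<longleftrightarrow> [x] \<in> carrier H \<and> [y] \<in> carrier H \<and> [x] \<sqsubseteq> [y]"

lemma def_pred_le_line: "def_pred (\<lambda>\<sigma>. le_line (\<sigma> i) (\<sigma> j))"
  unfolding le_line_def by (rule def_le)

lemma le_line_refl_iff: "le_line x x \<longleftrightarrow> [x] \<in> carrier H"
  by (auto simp: le_line_def)

lemma carrierE:
  assumes "x \<in> carrier H"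
  obtains a where "x = [a]" "le_line a a"
  using length_carrier[OF assms] assms by (auto simp: length_Suc_conv le_line_refl_iff)

lemma carrier_all_iff: "(\<forall>x\<in>carrier H. P x) \<longleftrightarrow> (\<forall>a. le_line a a \<longrightarrow> P [a])"
  by (metis carrierE le_line_refl_iff)

text \<open>A Yoneda principle: it turns an equation for a meet or an implication into a statement
  about the elements below, where the adjunction laws apply.\<close>

lemma eq_iff_below:
  assumes "x \<in> carrier H" "y \<in> carrier H"
  shows "x = y \<longleftrightarrow> (\<forall>w\<in>carrier H. w \<sqsubseteq> x \<longleftrightarrow> w \<sqsubseteq> y)"
  using le_antisym[OF _ _ assms] le_refl assms by metis

lemma eq_iff_above:
  assumes "x \<in> carrier H" "y \<in> carrier H"
  shows "x = y \<longleftrightarrow> (\<forall>w\<in>carrier H. x \<sqsubseteq> w \<longleftrightarrow> y \<sqsubseteq> w)"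
  using le_antisym[OF _ _ assms] le_refl assms by metis

lemma meet_line_iff:
  assumes "le_line a a" "le_line b b" "le_line c c"
  shows "[a] \<sqinter> [b] = [c] \<longleftrightarrow> (\<forall>w. le_line w w \<longrightarrow> (le_line w c \<longleftrightarrow> le_line w a \<and> le_line w b))"
proof -
  have "[a] \<sqinter> [b] = [c] \<longleftrightarrow> (\<forall>w\<in>carrier H. w \<sqsubseteq> [a] \<sqinter> [b] \<longleftrightarrow> w \<sqsubseteq> [c])"
    using assms by (intro eq_iff_below) (simp_all add: le_line_refl_iff)
  then show ?thesis
    using assms by (auto simp: carrier_all_iff le_line_def le_meet_iff)
qed

lemma join_line_iff:
  assumes "le_line a a" "le_line b b" "le_line c c"
  shows "[a] \<squnion> [b] = [c] \<longleftrightarrow> (\<forall>w. le_line w w \<longrightarrow> (le_line c w \<longleftrightarrow> le_line a w \<and> le_line b w))"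
proof -
  have "[a] \<squnion> [b] = [c] \<longleftrightarrow> (\<forall>w\<in>carrier H. [a] \<squnion> [b] \<sqsubseteq> w \<longleftrightarrow> [c] \<sqsubseteq> w)"
    using assms by (intro eq_iff_above) (simp_all add: le_line_refl_iff)
  then show ?thesis
    using assms by (auto simp: carrier_all_iff le_line_def join_le_iff)
qed

lemma himp_line_iff:
  assumes "le_line a a" "le_line b b" "le_line c c"
  shows "himp H [a] [b] = [c] \<longleftrightarrow> (\<forall>w. le_line w w \<longrightarrow>
    (le_line w c \<longleftrightarrow> (\<forall>v. le_line v v \<longrightarrow> le_line v a \<and> le_line v w \<longrightarrow> le_line v b)))"
proof -
  \<comment> \<open>The adjunction leaves the condition [a] \<sqinter> [w] \<sqsubseteq> [b], which
    still mentions a meet. Comparing down-sets eliminates it, at the cost of the inner quantifier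
    over \<open>v\<close>.\<close>
  have "x \<sqsubseteq> y \<longleftrightarrow> (\<forall>v\<in>carrier H. v \<sqsubseteq> x \<longrightarrow> v \<sqsubseteq> y)" if "x \<in> carrier H" "y \<in> carrier H" for x y
    using le_trans[OF _ _ _ that] le_refl that by metis
  from this[of "[a] \<sqinter> _" "[b]"]
  have *: "[a] \<sqinter> [w] \<sqsubseteq> [b] \<longleftrightarrow> (\<forall>v. le_line v v \<longrightarrow> le_line v a \<and> le_line v w \<longrightarrow> le_line v b)"
    if "le_line w w" for w
    using that assms by (auto simp: carrier_all_iff le_line_def le_meet_iff)
  have "himp H [a] [b] = [c] \<longleftrightarrow> (\<forall>w\<in>carrier H. w \<sqsubseteq> himp H [a] [b] \<longleftrightarrow> w \<sqsubseteq> [c])"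
    using assms by (intro eq_iff_below) (simp_all add: le_line_refl_iff himp_closed)
  also have "\<dots> \<longleftrightarrow> (\<forall>w. le_line w w \<longrightarrow> (le_line w c \<longleftrightarrow> [a] \<sqinter> [w] \<sqsubseteq> [b]))"
    using assms by (auto simp: carrier_all_iff le_line_def le_himp_iff)
  also have "\<dots> \<longleftrightarrow> (\<forall>w. le_line w w \<longrightarrow>
      (le_line w c \<longleftrightarrow> (\<forall>v. le_line v v \<longrightarrow> le_line v a \<and> le_line v w \<longrightarrow> le_line v b)))"
    using * by (simp cong: imp_cong)
  finally show ?thesis .
qed

lemma definable_binary_graph:
  assumes g: "\<And>x y. \<lbrakk>x \<in> carrier H; y \<in> carrier H\<rbrakk> \<Longrightarrow> g x y \<in> carrier H"
    and P: "def_pred (\<lambda>\<sigma>. P (\<sigma> 0) (\<sigma> 1) (\<sigma> 2))"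
    and g_iff: "\<And>a b c. \<lbrakk>le_line a a; le_line b b; le_line c c\<rbrakk> \<Longrightarrow> g [a] [b] = [c] \<longleftrightarrow> P a b c"
  shows "definable \<L> R 3 {x @ y @ g x y | x y. x \<in> carrier H \<and> y \<in> carrier H}"
proof (rule definableI)
  show "def_pred (\<lambda>\<sigma>. le_line (\<sigma> 0) (\<sigma> 0) \<and> le_line (\<sigma> 1) (\<sigma> 1) \<and> le_line (\<sigma> 2) (\<sigma> 2) \<and>
      P (\<sigma> 0) (\<sigma> 1) (\<sigma> 2))"
    by (intro def_pred_conj def_pred_le_line P)
  have "zs \<in> {x @ y @ g x y | x y. x \<in> carrier H \<and> y \<in> carrier H} \<longleftrightarrow>
    (\<exists>a b c. zs = [a, b, c] \<and> le_line a a \<and> le_line b b \<and> le_line c c \<and> P a b c)" for zs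
  proof
    assume "zs \<in> {x @ y @ g x y | x y. x \<in> carrier H \<and> y \<in> carrier H}"
    then obtain x y where xy: "zs = x @ y @ g x y" "x \<in> carrier H" "y \<in> carrier H"
      by blast
    obtain a b c where "x = [a]" "le_line a a" "y = [b]" "le_line b b" "g x y = [c]" "le_line c c"
      using carrierE[OF xy(2)] carrierE[OF xy(3)] carrierE[OF g[OF xy(2,3)]] by metis
    then show "\<exists>a b c. zs = [a, b, c] \<and> le_line a a \<and> le_line b b \<and> le_line c c \<and> P a b c"
      using xy(1) g_iff by auto
  next
    assume "\<exists>a b c. zs = [a, b, c] \<and> le_line a a \<and> le_line b b \<and> le_line c c \<and> P a b c"
    then obtain a b c where *: "zs = [a, b, c]" "le_line a a" "le_line b b" "le_line c c" "P a b c"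
      by blast
    then have "zs = [a] @ [b] @ g [a] [b]"
      using g_iff[of a b c] by simp
    then show "zs \<in> {x @ y @ g x y | x y. x \<in> carrier H \<and> y \<in> carrier H}"
      using * unfolding le_line_refl_iff by blast
  qed
  \<comment> \<open>The conditionals are the assignment of \<open>definableI\<close>, evaluated at
    the coordinates 0, 1 and 2.\<close>
  then show "zs \<in> {x @ y @ g x y | x y. x \<in> carrier H \<and> y \<in> carrier H} \<longleftrightarrow> length zs = 3 \<and>
      le_line (if (0::nat) < 3 then zs ! 0 else 0) (if (0::nat) < 3 then zs ! 0 else 0) \<and>
      le_line (if (1::nat) < 3 then zs ! 1 else 0) (if (1::nat) < 3 then zs ! 1 else 0) \<and>
      le_line (if (2::nat) < 3 then zs ! 2 else 0) (if (2::nat) < 3 then zs ! 2 else 0) \<and>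
      P (if (0::nat) < 3 then zs ! 0 else 0) (if (1::nat) < 3 then zs ! 1 else 0)
        (if (2::nat) < 3 then zs ! 2 else 0)" for zs
    by (auto simp: numeral_3_eq_3 length_Suc_conv)
qed

lemma definable_carrier: "definable \<L> R 1 (carrier H)"
proof (rule definableI)
  show "def_pred (\<lambda>\<sigma>. le_line (\<sigma> 0) (\<sigma> 0))"
    by (rule def_pred_le_line)
  show "x \<in> carrier H \<longleftrightarrow>
      length x = 1 \<and> le_line (if (0::nat) < 1 then x ! 0 else 0) (if (0::nat) < 1 then x ! 0 else 0)" for x
    using length_carrier[of x] by (auto simp: length_Suc_conv le_line_refl_iff)
qed

lemma definable_le: "definable \<L> R 2 {x @ y | x y. x \<in> carrier H \<and> y \<in> carrier H \<and> x \<sqsubseteq> y}"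
proof (rule definableI)
  show "def_pred (\<lambda>\<sigma>. le_line (\<sigma> 0) (\<sigma> 1))"
    by (rule def_pred_le_line)
  have "zs \<in> {x @ y | x y. x \<in> carrier H \<and> y \<in> carrier H \<and> x \<sqsubseteq> y} \<longleftrightarrow>
      (\<exists>a b. zs = [a, b] \<and> le_line a b)" for zs
  proof
    assume "zs \<in> {x @ y | x y. x \<in> carrier H \<and> y \<in> carrier H \<and> x \<sqsubseteq> y}"
    then obtain x y where xy: "zs = x @ y" "x \<in> carrier H" "y \<in> carrier H" "x \<sqsubseteq> y"
      by blast
    obtain a b where "x = [a]" "y = [b]"
      using carrierE[OF xy(2)] carrierE[OF xy(3)] by metis
    with xy show "\<exists>a b. zs = [a, b] \<and> le_line a b"
      by (simp add: le_line_def)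
  next
    assume "\<exists>a b. zs = [a, b] \<and> le_line a b"
    then obtain a b where "zs = [a] @ [b]" "le_line a b"
      by auto
    then show "zs \<in> {x @ y | x y. x \<in> carrier H \<and> y \<in> carrier H \<and> x \<sqsubseteq> y}"
      unfolding le_line_def by blast
  qed
  then show "zs \<in> {x @ y | x y. x \<in> carrier H \<and> y \<in> carrier H \<and> x \<sqsubseteq> y} \<longleftrightarrow> length zs = 2 \<and>
      le_line (if (0::nat) < 2 then zs ! 0 else 0) (if (1::nat) < 2 then zs ! 1 else 0)" for zs
    by (auto simp: numeral_2_eq_2 length_Suc_conv)
qed

lemma definable_heyting_algebra: "definable_heyting_algebra \<L> R H"
  unfolding definable_heyting_algebra_def
  using heyting_algebra_axioms definable_carrier definable_le
  by (intro conjI exI[of _ 1]) (simp_all add: numeral_2_eq_2)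

lemma definable_struct_heyting: "definable_struct \<L> R heyting_lang 1 (heyting_struct H)"
  unfolding definable_struct_def
proof (intro conjI allI)
  show "is_struct heyting_lang (heyting_struct H)"
    by (rule is_struct_heyting)
  show "definable \<L> R 1 (univ (heyting_struct H))"
    using definable_carrier by simp
next
  fix r :: heyting_rel
  have "{concat xs | xs. length xs = 2 \<and> set xs \<subseteq> carrier H \<and> xs ! 0 \<sqsubseteq> xs ! 1} =
      {x @ y | x y. x \<in> carrier H \<and> y \<in> carrier H \<and> x \<sqsubseteq> y}" (is "?A = ?B")
  proof (intro equalityI subsetI)
    fix z assume "z \<in> ?A"
    then obtain xs where "z = concat xs" "length xs = 2" "set xs \<subseteq> carrier H" "xs ! 0 \<sqsubseteq> xs ! 1"
      by blast
    moreover from this(2) obtain x y where "xs = [x, y]"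
      by (auto simp: numeral_2_eq_2 length_Suc_conv)
    ultimately have "z = x @ y" "x \<in> carrier H" "y \<in> carrier H" "x \<sqsubseteq> y"
      by simp_all
    then show "z \<in> ?B"
      by blast
  next
    fix z assume "z \<in> ?B"
    then obtain x y where "z = concat [x, y]" "x \<in> carrier H" "y \<in> carrier H" "x \<sqsubseteq> y"
      by auto
    then show "z \<in> ?A"
      by (intro CollectI exI[of _ "[x, y]"]) simp
  qed
  then show "definable \<L> R (1 * rel_ar heyting_lang r)
      {concat xs | xs. length xs = rel_ar heyting_lang r \<and> set xs \<subseteq> univ (heyting_struct H) \<and>
        rel_int (heyting_struct H) r xs}"
    using definable_le by (cases r) (simp add: heyting_lang_def)
next
  fix f :: heyting_fun
  have binary: "definable \<L> R 3 {concat xs @ heyting_op H f xs | xs. length xs = 2 \<and> set xs \<subseteq> carrier H}"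
    if "\<And>x y. heyting_op H f [x, y] = g x y"
      and "definable \<L> R 3 {x @ y @ g x y | x y. x \<in> carrier H \<and> y \<in> carrier H}" for g
  proof -
    have "{concat xs @ heyting_op H f xs | xs. length xs = 2 \<and> set xs \<subseteq> carrier H} =
      {x @ y @ g x y | x y. x \<in> carrier H \<and> y \<in> carrier H}" (is "?A = ?B")
    proof (intro equalityI subsetI)
      fix z assume "z \<in> ?A"
      then obtain xs where "z = concat xs @ heyting_op H f xs" "length xs = 2" "set xs \<subseteq> carrier H"
        by blast
      moreover from this(2) obtain x y where "xs = [x, y]"
        by (auto simp: numeral_2_eq_2 length_Suc_conv)
      ultimately have "z = x @ y @ g x y" "x \<in> carrier H" "y \<in> carrier H"
        using that(1) by simp_all
      then show "z \<in> ?B" by blast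
    next
      fix z assume "z \<in> ?B"
      then obtain x y where "z = x @ y @ g x y" "x \<in> carrier H" "y \<in> carrier H"
        by blast
      then show "z \<in> ?A"
        using that(1) by (intro CollectI exI[of _ "[x, y]"]) simp
    qed
    with that(2) show ?thesis by simp
  qed
  have nullary: "definable \<L> R 1 {concat xs @ heyting_op H f xs | xs. length xs = 0 \<and> set xs \<subseteq> carrier H}"
    if c: "heyting_op H f [] \<in> carrier H"
  proof -
    obtain a where "heyting_op H f [] = [a]"
      using carrierE[OF c] by metis
    then have "{concat xs @ heyting_op H f xs | xs. length xs = 0 \<and> set xs \<subseteq> carrier H} = {[a]}"
      by auto
    with definable_singleton show ?thesis by simp
  qed
  have meet: "definable \<L> R 3 {x @ y @ (x \<sqinter> y) | x y. x \<in> carrier H \<and> y \<in> carrier H}"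
  proof (rule definable_binary_graph[where g = "meet H" and
        P = "\<lambda>a b c. (\<forall>w. le_line w w \<longrightarrow> (le_line w c \<longleftrightarrow> le_line w a \<and> le_line w b))", OF _ _ meet_line_iff])
    \<comment> \<open>Index 3 is the first one after the coordinates of the graph. The unreduced
      application to \<open>\<sigma>(3 := w)\<close> has the shape that \<open>def_pred_all\<close>
      expects.\<close>
    have "def_pred (\<lambda>\<sigma>. \<forall>w. (\<lambda>\<tau>. le_line (\<tau> 3) (\<tau> 3) \<longrightarrow>
        (le_line (\<tau> 3) (\<tau> 2) \<longleftrightarrow> le_line (\<tau> 3) (\<tau> 0) \<and> le_line (\<tau> 3) (\<tau> 1))) (\<sigma>(3 := w)))"
      by (intro def_pred_intros def_pred_le_line)
    then show "def_pred (\<lambda>\<sigma>. \<forall>w. le_line w w \<longrightarrow>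
        (le_line w (\<sigma> 2) \<longleftrightarrow> le_line w (\<sigma> 0) \<and> le_line w (\<sigma> 1)))"
      by simp
  qed simp_all
  have join: "definable \<L> R 3 {x @ y @ (x \<squnion> y) | x y. x \<in> carrier H \<and> y \<in> carrier H}"
  proof (rule definable_binary_graph[where g = "join H" and
        P = "\<lambda>a b c. (\<forall>w. le_line w w \<longrightarrow> (le_line c w \<longleftrightarrow> le_line a w \<and> le_line b w))", OF _ _ join_line_iff])
    have "def_pred (\<lambda>\<sigma>. \<forall>w. (\<lambda>\<tau>. le_line (\<tau> 3) (\<tau> 3) \<longrightarrow>
        (le_line (\<tau> 2) (\<tau> 3) \<longleftrightarrow> le_line (\<tau> 0) (\<tau> 3) \<and> le_line (\<tau> 1) (\<tau> 3))) (\<sigma>(3 := w)))"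
      by (intro def_pred_intros def_pred_le_line)
    then show "def_pred (\<lambda>\<sigma>. \<forall>w. le_line w w \<longrightarrow>
        (le_line (\<sigma> 2) w \<longleftrightarrow> le_line (\<sigma> 0) w \<and> le_line (\<sigma> 1) w))"
      by simp
  qed simp_all
  have imp: "definable \<L> R 3 {x @ y @ himp H x y | x y. x \<in> carrier H \<and> y \<in> carrier H}"
  proof (rule definable_binary_graph[where g = "himp H" and
        P = "\<lambda>a b c. (\<forall>w. le_line w w \<longrightarrow>
    (le_line w c \<longleftrightarrow> (\<forall>v. le_line v v \<longrightarrow> le_line v a \<and> le_line v w \<longrightarrow> le_line v b)))", OF _ _ himp_line_iff])
    \<comment> \<open>The inner bound variable gets index 4, since index 3 still holds
      \<open>w\<close>.\<close>
    have "def_pred (\<lambda>\<sigma>. \<forall>w. (\<lambda>\<tau>. le_line (\<tau> 3) (\<tau> 3) \<longrightarrow> (le_line (\<tau> 3) (\<tau> 2) \<longleftrightarrow>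
        (\<forall>v. (\<lambda>\<rho>. le_line (\<rho> 4) (\<rho> 4) \<longrightarrow> le_line (\<rho> 4) (\<rho> 0) \<and> le_line (\<rho> 4) (\<rho> 3) \<longrightarrow>
          le_line (\<rho> 4) (\<rho> 1)) (\<tau>(4 := v))))) (\<sigma>(3 := w)))"
      by (intro def_pred_intros def_pred_le_line)
    then show "def_pred (\<lambda>\<sigma>. \<forall>w. le_line w w \<longrightarrow> (le_line w (\<sigma> 2) \<longleftrightarrow>
        (\<forall>v. le_line v v \<longrightarrow> le_line v (\<sigma> 0) \<and> le_line v w \<longrightarrow> le_line v (\<sigma> 1))))"
      by simp
  qed (simp_all add: himp_closed)
  show "definable \<L> R (1 * fun_ar heyting_lang f + 1)
      {concat xs @ fun_int (heyting_struct H) f xs | xs.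
        length xs = fun_ar heyting_lang f \<and> set xs \<subseteq> univ (heyting_struct H)}"
    using binary[OF _ meet] binary[OF _ join] binary[OF _ imp] nullary
    by (cases f) (simp_all add: heyting_lang_def del: length_0_conv)
qed

end

section \<open>Dimension on the line\<close>

text \<open>A band has points because the order of a linearly ordered field is dense and without end
  points. Nonemptiness lets the length of the index list be read off a point of the cell.\<close>

lemma cell_nonempty: "cell \<L> R is C \<Longrightarrow> C \<noteq> {}"
proof (induction rule: cell.induct)
  case (band "is" C lo hi)
  then obtain x where x: "x \<in> C" by blast
  have "\<exists>y. (\<forall>f. lo = Some f \<longrightarrow> f x < y) \<and> (\<forall>g. hi = Some g \<longrightarrow> y < g x)"
  proof (cases lo; cases hi)
    fix f g assume "lo = Some f" "hi = Some g"
    then show ?thesis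
      using dense[OF band.hyps(4)[OF _ _ x]] by auto
  next
    fix g assume "lo = None" "hi = Some g"
    then show ?thesis
      using lt_ex by auto
  next
    fix f assume "lo = Some f" "hi = None"
    then show ?thesis
      using gt_ex by auto
  qed simp
  with x show ?case by blast
qed auto

lemma length_cell: "\<lbrakk>cell \<L> R is C; x \<in> C\<rbrakk> \<Longrightarrow> length x = length is"
  by (induction arbitrary: x rule: cell.induct) auto

lemma cell_index: "cell \<L> R is C \<Longrightarrow> set is \<subseteq> {0, 1}"
  by (induction rule: cell.induct) auto

lemma odim_line_le:
  assumes "\<And>x. x \<in> X \<Longrightarrow> length x = 1"
  shows "odim \<L> R X \<le> 1"
  unfolding odim_def
proof (rule SUP_least)
  fix "is" assume "is \<in> {is. \<exists>C. cell \<L> R is C \<and> C \<subseteq> X}"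
  then obtain C where C: "cell \<L> R is C" "C \<subseteq> X" by blast
  then obtain x where "x \<in> C" using cell_nonempty by blast
  then have "length is = 1"
    using assms length_cell[OF C(1)] C(2) by force
  then obtain k where "is = [k]" "k \<le> 1"
    using cell_index[OF C(1)] by (auto simp: length_Suc_conv)
  then show "ereal (real (sum_list is)) \<le> 1"
    by simp
qed

lemma (in ordered_field_expansion) cell_interval:
  assumes "a < b"
  shows "cell \<L> R [1] {[x] | x. a < x \<and> x < b}"
proof -
  \<comment> \<open>The bounds are functions on the one-point space, so the graph of each is a
    singleton of the line, definable with \<open>c\<close> as parameter.\<close>
  have const: "definable_continuous \<L> R 0 {[]} (\<lambda>_. c)" for c
    using definable_singleton[of c] zero_less_one
    by (auto simp: definable_continuous_def continuous_on_list_def)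
  have "cell \<L> R ([] @ [1]) {x @ [y] | x y. x \<in> {[]} \<and>
      (\<forall>f. Some (\<lambda>_. a) = Some f \<longrightarrow> f x < y) \<and> (\<forall>g. Some (\<lambda>_. b) = Some g \<longrightarrow> y < g x)}"
    by (rule cell.band[OF cell.point]) (use const assms in auto)
  then show ?thesis by simp
qed

lemma (in ordered_field_expansion) odim_line_eq:
  assumes "\<And>x. x \<in> X \<Longrightarrow> length x = 1" "a < b" "{[x] | x. a < x \<and> x < b} \<subseteq> X"
  shows "odim \<L> R X = 1"
proof (rule antisym)
  show "odim \<L> R X \<le> 1"
    using assms(1) by (rule odim_line_le)
  have "[1] \<in> {is. \<exists>C. cell \<L> R is C \<and> C \<subseteq> X}"
    using cell_interval[OF assms(2)] assms(3) by blast
  then have "ereal (real (sum_list [1])) \<le> odim \<L> R X"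
    unfolding odim_def by (rule SUP_upper)
  then show "1 \<le> odim \<L> R X"
    by (simp add: one_ereal_def)
qed


section \<open>Equations without dimensional gap\<close>

abbreviation chain_gorder :: "'b set \<Rightarrow> ('b \<Rightarrow> 'l::linorder) \<Rightarrow> 'b gorder" where
  "chain_gorder C f \<equiv> \<lparr>carrier = C, eq = (=), le = \<lambda>u v. f u \<le> f v\<rparr>"

text \<open>
  A point strictly between the ends of a chain generates a three-element subalgebra, which can
  be copied to \<^typ>\<open>'h\<close>, where the hypothesis on \<^term>\<open>t\<close> applies.
\<close>

lemma hval_chain_interior:
  fixes x :: "'a::linordered_field"
  assumes t: "wf_tm heyting_lang t"
    and dense: "\<And>H :: ('h::infinite) gorder. heyting_algebra H \<Longrightarrow>
           solution_set H (hneg (hneg (Var 0))) \<subseteq> solution_set H t"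
    and x: "0 < x" "x < 1"
  shows "hval (chain_gorder {0..1} (\<lambda>x. x)) x t = 1"
proof -
  obtain B :: "'h set" where "finite B" "card B = 3"
    using infinite_arbitrarily_large[OF infinite_UNIV] by metis
  then obtain a b c :: 'h where abc: "a \<noteq> b" "b \<noteq> c" "a \<noteq> c"
    by (auto simp: card_3_iff)
  \<comment> \<open>The order on \<open>{a, b, c}\<close> is pulled back from the points 0,
    \<open>x\<close>, 1, so that \<open>f\<close> becomes an embedding into the chain
    [0, 1].\<close>
  define f where "f = (\<lambda>u. if u = a then 0 else if u = b then x else 1)"
  have f: "f a = 0" "f b = x" "f c = 1"
    using abc by (simp_all add: f_def)
  let ?T = "chain_gorder {a, b, c} f" and ?C = "chain_gorder {0..1} (\<lambda>x. x) :: 'a gorder"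
  have T: "heyting_operations ?T (\<lambda>u v. if f u \<le> f v then u else v) (\<lambda>u v. if f u \<le> f v then v else u)
      (\<lambda>u v. if f u \<le> f v then c else v) a c"
    by (rule heyting_operations_chain) (use x f in \<open>auto simp: inj_on_def\<close>)
  have C: "heyting_operations ?C (\<lambda>u v. if u \<le> v then u else v) (\<lambda>u v. if u \<le> v then v else u)
      (\<lambda>u v. if u \<le> v then 1 else v) 0 1"
    by (rule heyting_operations_chain[where f = "\<lambda>x. x"]) auto
  note T_eqs = heyting_operations.meet_eq[OF T] heyting_operations.join_eq[OF T]
    heyting_operations.himp_eq[OF T] heyting_operations.bottom_eq_bt[OF T] heyting_operations.top_eq_tp[OF T]
  note C_eqs = heyting_operations.meet_eq[OF C] heyting_operations.join_eq[OF C]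
    heyting_operations.himp_eq[OF C] heyting_operations.bottom_eq_bt[OF C] heyting_operations.top_eq_tp[OF C]
  have f_mem: "f u \<in> {0..1}" if "u \<in> {a, b, c}" for u
    using that x f by auto
  \<comment> \<open>The negation of the middle element is the bottom \<open>a\<close>, whose
    negation is the top \<open>c\<close>.\<close>
  have "hval ?T b (hneg (hneg (Var 0))) = c"
    using x f by (simp add: hneg_def T_eqs)
  then have "b \<in> solution_set ?T (hneg (hneg (Var 0)))"
    by (simp add: mem_solution_set_iff T_eqs)
  then have "hval ?T b t = c"
    using dense[OF heyting_operations.heyting_algebra[OF T]] by (auto simp: mem_solution_set_iff T_eqs)
  \<comment> \<open>In a chain the operations are determined by comparisons and the end points, all
    of which \<open>f\<close> preserves.\<close>
  moreover have "hval ?C (f b) t = f (hval ?T b t)"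
    by (rule hval_hom[OF heyting_operations.heyting_algebra[OF T] t])
      (use f f_mem in \<open>auto simp: T_eqs C_eqs\<close>)
  ultimately show ?thesis
    using f by simp
qed

lemma tm_val_cong: "(\<And>i. i \<in> tm_vars t \<Longrightarrow> e i = e' i) \<Longrightarrow> tm_val M e t = tm_val M e' t"
  by (induction t) (auto intro!: arg_cong[where f = "fun_int M _"], metis)

lemma concat_struct_power: "concat ` struct_power M 1 = univ M"
proof -
  have "struct_power M 1 = (\<lambda>x. [x]) ` univ M"
    by (auto simp: struct_power_def length_Suc_conv)
  then show ?thesis
    by (simp add: image_image)
qed

text \<open>The two notions of solution use different assignments: \<open>[x] ! i\<close> is
  unspecified for positive \<open>i\<close>, but a term in one variable only looks at index
  0.\<close>

lemma concat_solutions: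
  assumes "one_variable t"
  shows "concat ` solutions (heyting_struct H) 1 (eq_top t) = solution_set H t"
proof -
  have "tm_val (heyting_struct H) (\<lambda>i. [x] ! i) t = hval H x t" for x
    unfolding hval_def using assms by (intro tm_val_cong) (auto simp: one_variable_def)
  then have "solutions (heyting_struct H) 1 (eq_top t) = (\<lambda>x. [x]) ` solution_set H t"
    by (auto simp: solutions_def struct_power_def length_Suc_conv mem_solution_set_iff eq_top_def)
  then show ?thesis
    by (simp add: image_image)
qed

theorem proposition4p22:
  fixes \<L> :: "('f, 'r) lang"
    and R :: "('f, 'r, 'a::linordered_field) fo_struct"
    and t :: heyting_term
  assumes "o_minimal_field \<L> R"
    and "one_variable t"
    and "\<not> trivial_equation TYPE('h::infinite) t"
    and "\<And>H :: 'h gorder. heyting_algebra H \<Longrightarrow>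
           solution_set H (hneg (hneg (Var 0))) \<subseteq> solution_set H t"
  shows "\<not> dimensional_gap \<L> R heyting_lang heyting_theory 1 (eq_top t) \<and>
    (\<exists>L :: 'a list gorder. definable_heyting_algebra \<L> R L \<and> infinite (carrier L) \<and>
       solution_set L t \<noteq> carrier L \<and>
       odim \<L> R (solution_set L t) = odim \<L> R (carrier L))"
proof -
  have t: "wf_tm heyting_lang t"
    using assms(2) by (simp add: one_variable_def)
  interpret ordered_field_expansion \<L> R
    using assms(1) by (simp add: o_minimal_field_def ordered_field_expansion_def)
  obtain H :: "'h gorder" where H: "heyting_algebra H" "solution_set H t \<noteq> carrier H"
    using assms(3) by (auto simp: trivial_equation_def)
  have "solution_set H t \<subseteq> carrier H"
    by (auto simp: solution_set_def)
  with H(2) obtain x where "x \<in> carrier H" "hval H x t \<noteq> \<top>\<^bsub>H\<^esub>"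
    using mem_solution_set_iff[of _ H t] by blast
  then obtain D :: "'h gorder" and x where D: "heyting_algebra D" "finite (carrier D)"
    and x: "x \<in> carrier D" "hval D x t \<noteq> \<top>\<^bsub>D\<^esub>"
    using finite_model_property[OF H(1) t] by metis
  interpret D: heyting_algebra D by (rule D(1))
  define I :: "'a gorder" where "I = chain_gorder {0..1} (\<lambda>x. x)"
  have carrier_I: "carrier I = {0..1}" and le_I: "u \<sqsubseteq>\<^bsub>I\<^esub> v \<longleftrightarrow> u \<le> v" for u v
    by (simp_all add: I_def)
  have I: "heyting_operations I (\<lambda>u v. if u \<le> v then u else v) (\<lambda>u v. if u \<le> v then v else u)
      (\<lambda>u v. if u \<le> v then 1 else v) 0 1"
    unfolding I_def by (rule heyting_operations_chain[where f = "\<lambda>x. x"]) auto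
  interpret I: heyting_algebra I
    by (rule heyting_operations.heyting_algebra[OF I])
  have I_top: "\<top>\<^bsub>I\<^esub> = 1"
    by (rule heyting_operations.top_eq_tp[OF I])
  obtain idx :: "'h \<Rightarrow> nat" where idx: "inj_on idx (carrier D)"
    using finite_imp_inj_to_nat_seg[OF D(2)] by blast
  \<comment> \<open>Spacing 2 leaves a gap of length 1 between consecutive segments; with spacing 1
    the closed segments would share end points.\<close>
  define mk where "mk = (\<lambda>d (r::'a). [of_nat (2 * idx d) + r])"
  have inj: "inj_on (\<lambda>(d, r). mk d r) (carrier D \<times> {0..1})"
  proof (rule inj_onI, clarify)
    fix d r d' r'
    assume *: "d \<in> carrier D" "r \<in> {0..1}" "d' \<in> carrier D" "r' \<in> {0..1}" "mk d r = mk d' r'"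
    have less: "of_nat (2 * idx u) + s < of_nat (2 * idx v) + s'"
      if "idx u < idx v" "s \<in> {0..1}" "s' \<in> {0..1}" for u v and s s' :: 'a
    proof -
      have "2 * idx u + 2 \<le> 2 * idx v"
        using that by simp
      then have "of_nat (2 * idx u + 2) \<le> (of_nat (2 * idx v) :: 'a)"
        by (simp only: of_nat_le_iff)
      with that show ?thesis by simp
    qed
    have "idx d = idx d'"
      using less[of d d' r r'] less[of d' d r' r] * by (cases "idx d" "idx d'" rule: linorder_cases) (auto simp: mk_def)
    then show "d = d' \<and> r = r'"
      using * idx by (auto simp: mk_def dest: inj_onD)
  qed
  define p where "p u = fst (inv_into (carrier D \<times> {0..1}) (\<lambda>(d, r). mk d r) u)" for u
  define q where "q u = snd (inv_into (carrier D \<times> {0..1}) (\<lambda>(d, r). mk d r) u)" for u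
  have pq: "p (mk d r) = d" "q (mk d r) = r" if "d \<in> carrier D" "r \<in> carrier I" for d r
    using inv_into_f_f[OF inj, of "(d, r)"] that by (simp_all add: p_def q_def carrier_I)
  define L :: "'a list gorder" where "L = \<lparr>carrier = {mk d r | d r. d \<in> carrier D \<and> r \<in> carrier I}, eq = (=),
      le = \<lambda>u v. p u \<sqsubseteq>\<^bsub>D\<^esub> p v \<and> q u \<sqsubseteq>\<^bsub>I\<^esub> q v\<rparr>"
  have carrier_L: "carrier L = {mk d r | d r. d \<in> carrier D \<and> r \<in> carrier I}"
    and le_L: "u \<sqsubseteq>\<^bsub>L\<^esub> v \<longleftrightarrow> p u \<sqsubseteq>\<^bsub>D\<^esub> p v \<and> q u \<sqsubseteq>\<^bsub>I\<^esub> q v" for u v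
    by (simp_all add: L_def)
  have mk_mem: "mk d r \<in> carrier L" if "d \<in> carrier D" "r \<in> carrier I" for d r
    using that by (auto simp: carrier_L)
  have pq_mem: "p u \<in> carrier D" "q u \<in> carrier I" if "u \<in> carrier L" for u
    using that by (auto simp: carrier_L pq)
  note L_ops = heyting_operations_product[OF D(1) I.heyting_algebra_axioms pq, folded L_def]
  have L: "heyting_algebra L"
    by (rule heyting_operations.heyting_algebra[OF L_ops])
  note L_eqs = heyting_operations.meet_eq[OF L_ops] heyting_operations.join_eq[OF L_ops]
    heyting_operations.himp_eq[OF L_ops] heyting_operations.bottom_eq_bt[OF L_ops]
    heyting_operations.top_eq_tp[OF L_ops]
  \<comment> \<open>The projections are homomorphisms, so \<open>t\<close> is evaluated in each
    factor separately.\<close>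
  have p_hval: "p (hval L (mk d r) t) = hval D d t"
    if "d \<in> carrier D" "r \<in> carrier I" for d r
    using hval_hom[OF L t mk_mem[OF that], of p D] that
    by (simp add: L_eqs pq pq_mem D.himp_closed I.himp_closed)
  have q_hval: "q (hval L (mk d r) t) = hval I r t"
    if "d \<in> carrier D" "r \<in> carrier I" for d r
    using hval_hom[OF L t mk_mem[OF that], of q I] that
    by (simp add: L_eqs pq pq_mem D.himp_closed I.himp_closed)
  have mk_pq: "mk (p u) (q u) = u" if "u \<in> carrier L" for u
    using that by (auto simp: carrier_L pq)

  define low :: "'h \<Rightarrow> 'a" where "low d = of_nat (2 * idx d)" for d
  have mk_eq: "mk d r = [low d + r]" for d r
    by (simp add: mk_def low_def)
  \<comment> \<open>The comparison of the offsets \<open>u - low d\<close> and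
    \<open>v - low e\<close> is written with sums, for which \<open>def_tm\<close> has a rule. The
    order of \<open>D\<close> enters only through the finite index set of \<open>e\<close>, so that
    what remains under the quantifiers concerns the field alone.\<close>
  have le_L_iff: "[u] \<in> carrier L \<and> [v] \<in> carrier L \<and> [u] \<sqsubseteq>\<^bsub>L\<^esub> [v] \<longleftrightarrow>
      (\<exists>d\<in>carrier D. \<exists>e\<in>{e \<in> carrier D. d \<sqsubseteq>\<^bsub>D\<^esub> e}. low d \<le> u \<and> u \<le> low d + 1 \<and>
        low e \<le> v \<and> v \<le> low e + 1 \<and> u + low e \<le> v + low d)" (is "?l \<longleftrightarrow> ?r") for u v
  proof
    assume ?l
    then obtain d r e s where *: "d \<in> carrier D" "r \<in> carrier I" "[u] = mk d r"
      "e \<in> carrier D" "s \<in> carrier I" "[v] = mk e s" and le: "[u] \<sqsubseteq>\<^bsub>L\<^esub> [v]"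
      unfolding carrier_L by blast
    have "d \<sqsubseteq>\<^bsub>D\<^esub> e" "r \<le> s"
      using le * by (simp_all add: le_L pq le_I)
    with * show ?r
      by (intro bexI[of _ d] bexI[of _ e]) (auto simp: mk_eq carrier_I)
  next
    assume ?r
    then obtain d e where *: "d \<in> carrier D" "e \<in> carrier D" "d \<sqsubseteq>\<^bsub>D\<^esub> e"
      "low d \<le> u" "u \<le> low d + 1" "low e \<le> v" "v \<le> low e + 1" "u + low e \<le> v + low d"
      by blast
    have mem: "u - low d \<in> carrier I" "v - low e \<in> carrier I"
      using * by (simp_all add: carrier_I algebra_simps)
    have le: "u - low d \<le> v - low e"
      using * by (simp add: algebra_simps)
    have eq: "[u] = mk d (u - low d)" "[v] = mk e (v - low e)"
      by (simp_all add: mk_eq)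
    show ?l
      unfolding eq using * mem le mk_mem by (simp add: le_L pq le_I)
  qed
  have def_low: "def_tm (\<lambda>_. low d)" for d
    unfolding low_def by (rule def_tm_of_nat)
  interpret L: definable_heyting_line \<L> R L
  proof (intro definable_heyting_line.intro definable_heyting_line_axioms.intro)
    show "ordered_field_expansion \<L> R" by unfold_locales
    show "length u = 1" if "u \<in> carrier L" for u
      using that by (auto simp: carrier_L mk_def)
    show "def_pred (\<lambda>\<sigma>. [\<sigma> i] \<in> carrier L \<and> [\<sigma> j] \<in> carrier L \<and> [\<sigma> i] \<sqsubseteq>\<^bsub>L\<^esub> [\<sigma> j])" for i j
      unfolding le_L_iff
      by (intro def_pred_bex def_pred_conj def_pred_le def_tm_add def_tm_var def_low def_tm_one)
        (use D(2) in auto)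
  qed (rule L)

  \<comment> \<open>The first coordinate of the solutions to be exhibited is \<top>, which is its
    own double negation; the hypothesis on \<open>t\<close> applies since \<open>D\<close> is
    carried by \<open>'h\<close>.\<close>
  have "\<top>\<^bsub>D\<^esub> \<in> solution_set D (hneg (hneg (Var 0)))"
  proof -
    have "himp D \<bottom>\<^bsub>D\<^esub> \<bottom>\<^bsub>D\<^esub> = \<top>\<^bsub>D\<^esub>"
      by (rule D.top_eq) (simp_all add: D.himp_closed D.le_himp_iff D.bottom_meet_eq)
    moreover have "himp D \<top>\<^bsub>D\<^esub> \<bottom>\<^bsub>D\<^esub> = \<bottom>\<^bsub>D\<^esub>"
      using D.le_himp_iff[of "\<top>\<^bsub>D\<^esub>" "\<bottom>\<^bsub>D\<^esub>" "himp D \<top>\<^bsub>D\<^esub> \<bottom>\<^bsub>D\<^esub>"]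
      by (intro D.le_antisym) (simp_all add: D.himp_closed D.top_meet_eq)
    ultimately show ?thesis
      by (simp add: mem_solution_set_iff hneg_def)
  qed
  then have D_top: "hval D \<top>\<^bsub>D\<^esub> t = \<top>\<^bsub>D\<^esub>"
    using subsetD[OF assms(4)[OF D(1)]] by (simp add: mem_solution_set_iff)
  \<comment> \<open>The left end of the segment over the top element of \<open>D\<close>.\<close>
  define a where "a = low \<top>\<^bsub>D\<^esub>"
  have interval: "{[u] | u. a < u \<and> u < a + 1} \<subseteq> solution_set L t"
  proof (rule subsetI)
    fix z assume "z \<in> {[u] | u. a < u \<and> u < a + 1}"
    then obtain u where u: "z = [u]" "a < u" "u < a + 1" by blast
    define r where "r = u - a"
    have r: "0 < r" "r < 1" "r \<in> carrier I" and z: "z = mk \<top>\<^bsub>D\<^esub> r"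
      using u by (auto simp: r_def carrier_I mk_eq a_def algebra_simps)
    have "hval I r t = \<top>\<^bsub>I\<^esub>"
      unfolding I_top unfolding I_def using t assms(4) r(1,2) by (rule hval_chain_interior)
    then have "p (hval L z t) = \<top>\<^bsub>D\<^esub>" "q (hval L z t) = \<top>\<^bsub>I\<^esub>"
      using r D_top by (simp_all add: z p_hval q_hval)
    moreover have "z \<in> carrier L"
      using r z by (simp add: mk_mem)
    moreover from this have "mk (p (hval L z t)) (q (hval L z t)) = hval L z t"
      using t by (intro mk_pq L.hval_closed)
    ultimately show "z \<in> solution_set L t"
      by (simp add: mem_solution_set_iff L_eqs)
  qed
  have sub: "solution_set L t \<subseteq> carrier L"
    by (auto simp: solution_set_def)
  \<comment> \<open>Both sets lie on the line and contain the same open interval, so both have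
    dimension 1.\<close>
  have odim: "odim \<L> R (solution_set L t) = odim \<L> R (carrier L)"
    using odim_line_eq[of "solution_set L t" a "a + 1"] odim_line_eq[of "carrier L" a "a + 1"]
      interval sub L.length_carrier by force
  \<comment> \<open>The failure comes from the first coordinate; \<bottom> merely picks a point of
    the segment over \<open>x\<close>.\<close>
  have "mk x \<bottom>\<^bsub>I\<^esub> \<notin> solution_set L t"
    using p_hval[OF x(1) I.bottom_closed] x(2) by (auto simp: mem_solution_set_iff L_eqs pq)
  with mk_mem[OF x(1) I.bottom_closed] have proper: "solution_set L t \<noteq> carrier L"
    by blast
  have "infinite ((\<lambda>u. [u]) ` {a<..<a + 1})"
    by (subst finite_image_iff) (auto simp: inj_on_def)
  moreover have "(\<lambda>u. [u]) ` {a<..<a + 1} \<subseteq> carrier L"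
    by (rule order_trans[OF _ order_trans[OF interval sub]]) auto
  ultimately have inf: "infinite (carrier L)"
    by (rule infinite_super[rotated])
  have power: "concat ` struct_power (heyting_struct L) 1 = carrier L"
    by (simp only: concat_struct_power heyting_struct_simps(1))
  have sols: "concat ` solutions (heyting_struct L) 1 (eq_top t) = solution_set L t"
    using assms(2) by (rule concat_solutions)
  have "\<not> dimensional_gap \<L> R heyting_lang heyting_theory 1 (eq_top t)"
  proof
    assume "dimensional_gap \<L> R heyting_lang heyting_theory 1 (eq_top t)"
    then have "odim \<L> R (carrier L) > odim \<L> R (solution_set L t) \<or>
        struct_power (heyting_struct L) 1 = solutions (heyting_struct L) 1 (eq_top t)"
      using L.definable_struct_heyting inf L.models_heyting_theory power sols
      unfolding dimensional_gap_def by (metis heyting_struct_simps(1))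
    then have "carrier L = solution_set L t"
      using odim power sols by auto
    with proper show False by simp
  qed
  with L.definable_heyting_algebra inf proper odim show ?thesis
    by blast
qed

end
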